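(* Consider the setting described in the context, assume A1–A5, and let $s=\frac{r}{2-4r}$ (so $r=\frac{2s}{1+4s}$). Then for every $P_0>0$ the set $\bar{\mathbb{B}}^s_{2\infty}(P_0)$ is a maxiset for the test statistics $T_n$.
   Context: Fix $\sigma>0$, $0<r<1/2$ and an orthonormal basis $(\phi_j)_{j\ge1}$ of $\mathbb{L}_2(0,1)$. For each $n$ one observes $dY_n(t)=f(t)\,dt+\sigma n^{-1/2}dw(t)$, $t\in[0,1]$, equivalently $y_j=\theta_j+\sigma n^{-1/2}\xi_j$ with $\theta_j=\int_0^1f\phi_j$, $\xi_j$ i.i.d. $N(0,1)$; $H_0:f=0$. Weights $\kappa_{nj}^2\ge0$, $\rho_n=\sum_j\kappa_{nj}^2$, $T_n(Y_n)=\sum_j\kappa_{nj}^2y_j^2-\sigma^2n^{-1}\rho_n$, $k_n=\sup\{k:\sum_{j<k}\kappa_{nj}^2\le\rho_n/2\}$, $\kappa_n^2=\kappa_{nk_n}^2$. Assumptions: (A1) $j\mapsto\kappa_{nj}^2$ decreasing; (A2) $C_1<\sigma^{-4}n^2\sum_j\kappa_{nj}^4<C_2$; (A3) $c_1n^{-2r}\le\rho_n\le c_2n^{-2r}$; (A4) $\exists C_1>0,\lambda>1$: $\kappa^2_{n,[(1+\delta)k_n]}<C_1(1+\delta)^{-\lambda}\kappa_n^2$ for all $\delta>0$, $n$; (A5) $\kappa_{n1}^2\asymp\kappa_n^2$ and for each $c>1$ there is $C>0$ with $\kappa^2_{n,[ck_n]}\ge C\kappa_n^2$. A test generated by $T_n$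 rejects $H_0$ iff $T_n$ exceeds a threshold. For a sequence $n_i\to\infty$ and functions $f_{n_i}$, the (sub)sequence is consistent if for every $\alpha\in(0,1)$ and every sequence of tests $K_{n_i}$ generated by $T_{n_i}$ with $\alpha(K_{n_i})=\alpha(1+o(1))$, $\limsup_i\beta(K_{n_i},f_{n_i})<1-\alpha$; it is inconsistent if for every sequence of tests $K_{n_i}$ generated by $T_{n_i}$, $\liminf_i(\alpha(K_{n_i})+\beta(K_{n_i},f_{n_i}))\ge1$. Define $\bar{\mathbb{B}}^s_{2\infty}(P_0)=\{f=\sum_j\theta_j\phi_j:\ \sup_{\lambda>0}\lambda^{2s}\sum_{j>\lambda}\theta_j^2\le P_0\}$. A set $U\subset\mathbb{L}_2(0,1)$ is ortho-symmetric if $\sum_j\theta_j\phi_j\in U$ implies $\sum_j\pm\theta_j\phi_j\in U$ for every choice of signs. For a closed bounded convex set $U$, $\Im_U=\bigcup_{\gamma>0}\gamma U$ is the space with unit ball $U$. A bounded closed set $U$ is a maxiset for $T_n$ if: (i) $U$ is convex; (ii) $U$ is ortho-symmetric; (iii) for any $0<c<C$, every subsequence $f_{n_i}\in U$ with $cn_i^{-r}<\|f_{n_i}\|<Cn_i^{-r}$, $n_i\to\infty$, is consistent; (iv) if $f\notin\Im_U$, then every convex ortho-symmetric set $V$ containing $f$ contains an inconsistent subsequence $f_{n_i}\in V$ with $cn_i^{-r}<\|f_{n_i}\|<Cn_i^{-r}$ for some $0<c<C$, $n_i\to\infty$. *)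

theory Defs
  imports "HOL-Probability.Probability"
begin

text \<open>Conventions. A function f in L2(0,1) is identified (via the fixed orthonormal
basis phi_1, phi_2, ...) with its coefficient sequence. We index from 0:
th i is theta_(i+1). Likewise the weights: kap n i is kappa^2_(n,i+1) (already the
squared weight). The noise xi i is xi_(i+1).\<close>

definition l2 :: "(nat \<Rightarrow> real) set" where
  "l2 = {th. summable (\<lambda>i. (th i)\<^sup>2)}"

definition l2norm :: "(nat \<Rightarrow> real) \<Rightarrow> real" where
  "l2norm th = sqrt (\<Sum>i. (th i)\<^sup>2)"

text \<open>kappa^2_(n,j) with the paper's index j \<ge> 1\<close>
definition kw :: "(nat \<Rightarrow> nat \<Rightarrow> real) \<Rightarrow> nat \<Rightarrow> nat \<Rightarrow> real" where
  "kw kap n j = kap n (j - 1)"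

definition rho :: "(nat \<Rightarrow> nat \<Rightarrow> real) \<Rightarrow> nat \<Rightarrow> real" where
  "rho kap n = (\<Sum>i. kap n i)"

definition kn :: "(nat \<Rightarrow> nat \<Rightarrow> real) \<Rightarrow> nat \<Rightarrow> nat" where
  "kn kap n = Sup {k. 1 \<le> k \<and> (\<Sum>j\<in>{1..<k}. kw kap n j) \<le> rho kap n / 2}"

definition kapn :: "(nat \<Rightarrow> nat \<Rightarrow> real) \<Rightarrow> nat \<Rightarrow> real" where
  "kapn kap n = kw kap n (kn kap n)"

definition kapat :: "(nat \<Rightarrow> nat \<Rightarrow> real) \<Rightarrow> nat \<Rightarrow> real \<Rightarrow> real" where
  "kapat kap n c = kw kap n (nat \<lfloor>c * real (kn kap n)\<rfloor>)"

definition noise :: "(nat \<Rightarrow> real) measure" where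
  "noise = (\<Pi>\<^sub>M i\<in>(UNIV::nat set). std_normal_distribution)"

text \<open>T_n(Y_n) with y_j = theta_j + sigma n^(-1/2) xi_j\<close>
definition Tstat :: "(nat \<Rightarrow> nat \<Rightarrow> real) \<Rightarrow> real \<Rightarrow> nat \<Rightarrow> (nat \<Rightarrow> real) \<Rightarrow> (nat \<Rightarrow> real) \<Rightarrow> real" where
  "Tstat kap \<sigma> n th \<xi> =
     (\<Sum>i. kap n i * (th i + \<sigma> / sqrt (real n) * \<xi> i)\<^sup>2) - \<sigma>\<^sup>2 / real n * rho kap n"

definition alpha_err :: "(nat \<Rightarrow> nat \<Rightarrow> real) \<Rightarrow> real \<Rightarrow> nat \<Rightarrow> real \<Rightarrow> real" where
  "alpha_err kap \<sigma> n t = measure noise {\<xi> \<in> space noise. Tstat kap \<sigma> n (\<lambda>_. 0) \<xi> > t}"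

definition beta_err :: "(nat \<Rightarrow> nat \<Rightarrow> real) \<Rightarrow> real \<Rightarrow> nat \<Rightarrow> real \<Rightarrow> (nat \<Rightarrow> real) \<Rightarrow> real" where
  "beta_err kap \<sigma> n t th = measure noise {\<xi> \<in> space noise. Tstat kap \<sigma> n th \<xi> \<le> t}"

definition consistent :: "(nat \<Rightarrow> nat \<Rightarrow> real) \<Rightarrow> real \<Rightarrow> (nat \<Rightarrow> nat) \<Rightarrow> (nat \<Rightarrow> nat \<Rightarrow> real) \<Rightarrow> bool" where
  "consistent kap \<sigma> ns fs \<longleftrightarrow>
     (\<forall>\<alpha>. 0 < \<alpha> \<and> \<alpha> < 1 \<longrightarrow>
       (\<forall>t :: nat \<Rightarrow> real.
          ((\<lambda>i. alpha_err kap \<sigma> (ns i) (t i) / \<alpha>) \<longlonglongrightarrow> 1) \<longrightarrow>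
          limsup (\<lambda>i. ereal (beta_err kap \<sigma> (ns i) (t i) (fs i))) < ereal (1 - \<alpha>)))"

definition inconsistent :: "(nat \<Rightarrow> nat \<Rightarrow> real) \<Rightarrow> real \<Rightarrow> (nat \<Rightarrow> nat) \<Rightarrow> (nat \<Rightarrow> nat \<Rightarrow> real) \<Rightarrow> bool" where
  "inconsistent kap \<sigma> ns fs \<longleftrightarrow>
     (\<forall>t :: nat \<Rightarrow> real.
        liminf (\<lambda>i. ereal (alpha_err kap \<sigma> (ns i) (t i) + beta_err kap \<sigma> (ns i) (t i) (fs i))) \<ge> 1)"

definition l2convex :: "(nat \<Rightarrow> real) set \<Rightarrow> bool" where
  "l2convex U \<longleftrightarrow> (\<forall>x\<in>U. \<forall>y\<in>U. \<forall>u::real. 0 \<le> u \<and> u \<le> 1 \<longrightarrow> (\<lambda>i. u * x i + (1 - u) * y i) \<in> U)"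

definition ortho_symmetric :: "(nat \<Rightarrow> real) set \<Rightarrow> bool" where
  "ortho_symmetric U \<longleftrightarrow> (\<forall>th\<in>U. \<forall>sg :: nat \<Rightarrow> bool. (\<lambda>i. (if sg i then th i else - th i)) \<in> U)"

definition l2bounded :: "(nat \<Rightarrow> real) set \<Rightarrow> bool" where
  "l2bounded U \<longleftrightarrow> (\<exists>B. \<forall>th\<in>U. l2norm th \<le> B)"

definition l2closed :: "(nat \<Rightarrow> real) set \<Rightarrow> bool" where
  "l2closed U \<longleftrightarrow> (\<forall>x :: nat \<Rightarrow> nat \<Rightarrow> real. \<forall>th\<in>l2. (\<forall>m. x m \<in> U) \<and>
       ((\<lambda>m. l2norm (\<lambda>i. x m i - th i)) \<longlonglongrightarrow> 0) \<longrightarrow> th \<in> U)"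

definition span_space :: "(nat \<Rightarrow> real) set \<Rightarrow> (nat \<Rightarrow> real) set" where
  "span_space U = (\<Union>\<gamma>\<in>{0<..}. (\<lambda>th. (\<lambda>i. \<gamma> * th i)) ` U)"

definition in_shell :: "real \<Rightarrow> real \<Rightarrow> real \<Rightarrow> (nat \<Rightarrow> nat) \<Rightarrow> (nat \<Rightarrow> nat \<Rightarrow> real) \<Rightarrow> bool" where
  "in_shell r c C ns fs \<longleftrightarrow> (\<forall>i. c * real (ns i) powr (- r) < l2norm (fs i) \<and>
                                   l2norm (fs i) < C * real (ns i) powr (- r))"

definition maxiset :: "(nat \<Rightarrow> nat \<Rightarrow> real) \<Rightarrow> real \<Rightarrow> real \<Rightarrow> (nat \<Rightarrow> real) set \<Rightarrow> bool" where
  "maxiset kap \<sigma> r U \<longleftrightarrow>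
     U \<subseteq> l2 \<and> l2bounded U \<and> l2closed U \<and>
     l2convex U \<and> ortho_symmetric U \<and>
     (\<forall>c C. 0 < c \<and> c < C \<longrightarrow>
        (\<forall>ns fs. filterlim ns at_top sequentially \<and> (\<forall>i. fs i \<in> U) \<and> in_shell r c C ns fs
           \<longrightarrow> consistent kap \<sigma> ns fs)) \<and>
     (\<forall>f\<in>l2. f \<notin> span_space U \<longrightarrow>
        (\<forall>V. V \<subseteq> l2 \<and> l2convex V \<and> ortho_symmetric V \<and> f \<in> V \<longrightarrow>
           (\<exists>c C ns fs. 0 < c \<and> c < C \<and> filterlim ns at_top sequentially \<and>
              (\<forall>i. fs i \<in> V) \<and> in_shell r c C ns fs \<and> inconsistent kap \<sigma> ns fs)))"

definition besov_ball :: "real \<Rightarrow> real \<Rightarrow> (nat \<Rightarrow> real) set" where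
  "besov_ball s P0 = {th \<in> l2. \<forall>lam>0. lam powr (2 * s) *
       (\<Sum>i. if real (Suc i) > lam then (th i)\<^sup>2 else 0) \<le> P0}"

end

theory Submission
  imports Defs
begin

text \<open>
Write \<open>\<tau> = \<sigma> / sqrt n\<close>. Divided by its null standard deviation \<open>\<tau>\<^sup>2 sqrt (2 \<Sum> \<kappa>\<^sup>4)\<close>, the statistic
\<open>T\<close> is a sum of independent terms whose mean is the signal \<open>m\<close>, that is \<open>\<Sum> \<kappa>\<^sup>2 \<theta>\<^sup>2\<close> over the same scale.
All coefficients are at most of order \<open>n powr (2 r - 1)\<close>, so as long as \<open>m\<close> stays bounded the
standardized statistic minus \<open>m\<close> is asymptotically standard normal, under the hypothesis as well as
under the alternative. Hence signals bounded away from 0 are consistent, and signals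
tending to 0 are inconsistent, the latter because convergence to a continuous distribution function is uniform in the threshold.

The assumptions force \<open>\<kappa>\<^sub>n\<^sup>2\<close> and \<open>k\<^sub>n\<close> to be of the exact orders \<open>n powr (2 r - 2)\<close> and \<open>n powr (2 - 4 r)\<close>,
and \<open>k\<^sub>n powr (2 s)\<close> is of order \<open>n powr (2 r)\<close>. A function of the Besov ball of norm of order
\<open>n powr (- r)\<close> therefore carries half of its squared norm on the first \<open>C k\<^sub>n\<close> coordinates, where
the weights are of order \<open>\<kappa>\<^sub>n\<^sup>2\<close>, and its signal is bounded below. If \<open>f\<close> lies outside the space, there are
\<open>\<lambda>\<close> for which \<open>\<lambda> powr (2 s)\<close> times the squared norm of the tail of \<open>f\<close> beyond \<open>\<lambda>\<close> is arbitrarily large; the tail lies in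
every convex ortho-symmetric set containing \<open>f\<close>, and if \<open>n\<close> is chosen so that its norm is of order
\<open>n powr (- r)\<close>, then \<open>\<lambda> / k\<^sub>n\<close> is large and the signal is small by (A4).
\<close>

section \<open>Quadratic functionals of one Gaussian coordinate\<close>

lemma prob_space_noise: "prob_space noise"
  unfolding noise_def by (intro prob_space_PiM prob_space_normal_density) simp

lemma noise_component_measurable [measurable]: "(\<lambda>\<xi>. \<xi> i) \<in> borel_measurable noise"
proof -
  have "(\<lambda>\<xi>. \<xi> i) \<in> measurable noise (std_normal_distribution)"
    unfolding noise_def by (rule measurable_component_singleton) simp
  then show ?thesis by simp
qed

lemma distr_noise_component: "distr noise borel (\<lambda>\<xi>. \<xi> i) = std_normal_distribution"
proof -
  have "distr noise std_normal_distribution (\<lambda>\<xi>. \<xi> i) = std_normal_distribution"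
    unfolding noise_def
    by (intro distr_PiM_component[where M="\<lambda>_. std_normal_distribution"] prob_space_normal_density) auto
  moreover have "distr noise std_normal_distribution (\<lambda>\<xi>. \<xi> i) = distr noise borel (\<lambda>\<xi>. \<xi> i)"
    by (intro distr_cong) auto
  ultimately show ?thesis by simp
qed

text \<open>A family is independent iff its joint law is the product of its marginals, and
  \<open>noise\<close> is by construction such a product.\<close>

lemma indep_vars_noise: "prob_space.indep_vars noise (\<lambda>_. borel) (\<lambda>i \<xi>. \<xi> i) UNIV"
proof (subst prob_space.indep_vars_iff_distr_eq_PiM[OF prob_space_noise])
  show "distr noise (\<Pi>\<^sub>M i\<in>UNIV. borel) (\<lambda>x. \<lambda>i\<in>UNIV. x i) =
        (\<Pi>\<^sub>M i\<in>UNIV. distr noise borel (\<lambda>\<xi>. \<xi> i))"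
  proof -
    have "distr noise (\<Pi>\<^sub>M i\<in>UNIV. borel) (\<lambda>x. \<lambda>i\<in>UNIV. x i) = distr noise noise (\<lambda>x. x)"
      by (intro distr_cong) (auto simp: noise_def intro!: sets_PiM_cong)
    also have "\<dots> = noise" by simp
    finally show ?thesis by (simp add: distr_noise_component) (simp add: noise_def)
  qed
qed auto

lemma std_normal_moments:
  "integral\<^sup>L std_normal_distribution (\<lambda>x. x) = 0"
  "integral\<^sup>L std_normal_distribution (\<lambda>x. x\<^sup>2) = 1"
  "integral\<^sup>L std_normal_distribution (\<lambda>x. x ^ 3) = 0"
  "integral\<^sup>L std_normal_distribution (\<lambda>x. x ^ 4) = 3"
  using integral_std_normal_distribution_moment_odd[of 1]
    integral_std_normal_distribution_moment_odd[of 3]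
    std_normal_distribution_even_moments(1)[of 1]
    std_normal_distribution_even_moments(1)[of 2]
  by (simp_all add: fact_numeral)

lemma integrable_std_normal_distribution_moments [simp]:
  "integrable std_normal_distribution (\<lambda>x. x)"
  "integrable std_normal_distribution (\<lambda>x. x ^ k)"
  using integrable_std_normal_distribution_moment[of 1] integrable_std_normal_distribution_moment[of k]
  by simp_all

text \<open>One coordinate of the standardized statistic: \<open>b\<close> is the normalized weight,
  \<open>h\<close> the coefficient in units of the noise level, and subtracting
  \<open>1 + h\<^sup>2\<close>, the mean of the noncentral square, centres the term.\<close>

definition qterm :: "real \<Rightarrow> real \<Rightarrow> real \<Rightarrow> real" where
  "qterm b h x = b * ((h + x)\<^sup>2 - 1 - h\<^sup>2)"

lemma qterm_measurable [measurable]: "qterm b h \<in> borel_measurable borel"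
  unfolding qterm_def by measurable

lemma qterm_moments:
  shows "integrable std_normal_distribution (qterm b h)"
    and "integral\<^sup>L std_normal_distribution (qterm b h) = 0"
    and "integrable std_normal_distribution (\<lambda>x. (qterm b h x)\<^sup>2)"
    and "integral\<^sup>L std_normal_distribution (\<lambda>x. (qterm b h x)\<^sup>2) = b\<^sup>2 * (2 + 4 * h\<^sup>2)"
proof -
  interpret N: prob_space std_normal_distribution by (rule prob_space_normal_density) simp
  \<comment> \<open>Expanded in powers of \<open>x\<close>, all four claims reduce to the first four
    normal moments.\<close>
  have 1: "qterm b h = (\<lambda>x. b * x\<^sup>2 + 2 * b * h * x - b)"
    by (auto simp: qterm_def power2_eq_square algebra_simps)
  have 2: "(\<lambda>x. (qterm b h x)\<^sup>2) = (\<lambda>x. b\<^sup>2 * x ^ 4 + (4 * b\<^sup>2 * h) * x ^ 3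
      + (4 * b\<^sup>2 * h\<^sup>2 - 2 * b\<^sup>2) * x\<^sup>2 - (4 * b\<^sup>2 * h) * x + b\<^sup>2)"
    by (auto simp: qterm_def power2_eq_square power3_eq_cube power4_eq_xxxx algebra_simps)
  show "integrable std_normal_distribution (qterm b h)" unfolding 1 by auto
  show "integrable std_normal_distribution (\<lambda>x. (qterm b h x)\<^sup>2)" unfolding 2
    by (intro Bochner_Integration.integrable_add Bochner_Integration.integrable_diff
        integrable_mult_right integrable_std_normal_distribution_moments) auto
  show "integral\<^sup>L std_normal_distribution (qterm b h) = 0"
    unfolding 1 by (simp add: std_normal_moments N.prob_space[simplified])
  show "integral\<^sup>L std_normal_distribution (\<lambda>x. (qterm b h x)\<^sup>2) = b\<^sup>2 * (2 + 4 * h\<^sup>2)"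
    unfolding 2 by (simp add: std_normal_moments N.prob_space[simplified]) (simp add: algebra_simps)
qed

text \<open>Convexity of the cube gives the constant 4; for nonnegative arguments the difference of
  the two sides factors as a nonnegative multiple of a square.\<close>

lemma abs_add_cube_le: "\<bar>x + y\<bar> ^ 3 \<le> 4 * (\<bar>x\<bar> ^ 3 + \<bar>y\<bar> ^ 3)" for x y :: real
proof -
  have "\<bar>x + y\<bar> ^ 3 \<le> (\<bar>x\<bar> + \<bar>y\<bar>) ^ 3" by (intro power_mono) auto
  also have "\<dots> \<le> 4 * (\<bar>x\<bar> ^ 3 + \<bar>y\<bar> ^ 3)"
  proof -
    have "4 * (\<bar>x\<bar> ^ 3 + \<bar>y\<bar> ^ 3) - (\<bar>x\<bar> + \<bar>y\<bar>) ^ 3 = 3 * (\<bar>x\<bar> + \<bar>y\<bar>) * (\<bar>x\<bar> - \<bar>y\<bar>)\<^sup>2"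
      by (simp add: power2_eq_square power3_eq_cube algebra_simps)
    moreover have "0 \<le> 3 * (\<bar>x\<bar> + \<bar>y\<bar>) * (\<bar>x\<bar> - \<bar>y\<bar>)\<^sup>2" by simp
    ultimately show ?thesis by linarith
  qed
  finally show ?thesis .
qed

text \<open>The constant must not depend on \<open>b\<close> or \<open>h\<close>, since it serves
  all coordinates and all sample sizes at once. Once the factor
  \<open>b ^ 3 * (1 + \<bar>h\<bar> ^ 3)\<close> is pulled out, an integrable function of
  \<open>x\<close> alone dominates.\<close>

lemma qterm_third_moment:
  obtains K where "0 \<le> K"
    "\<And>b h. 0 \<le> b \<Longrightarrow> integrable std_normal_distribution (\<lambda>x. \<bar>qterm b h x\<bar> ^ 3)"
    "\<And>b h. 0 \<le> b \<Longrightarrow> integral\<^sup>L std_normal_distribution (\<lambda>x. \<bar>qterm b h x\<bar> ^ 3) \<le> K * (b ^ 3 * (1 + \<bar>h\<bar> ^ 3))"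
proof -
  \<comment> \<open>The coefficients come from two uses of \<open>abs_add_cube_le\<close>: 4 times
    \<open>4 * (x ^ 6 + 1)\<close>, and 4 times the 8 in the cube of
    \<open>2 * h * x\<close>.\<close>
  define g where "g = (\<lambda>x::real. 16 * (x ^ 6 + 1) + 32 * \<bar>x ^ 3\<bar>)"
  have g: "integrable std_normal_distribution g" unfolding g_def
    by (intro Bochner_Integration.integrable_add integrable_mult_right integrable_abs integrable_std_normal_distribution_moments)
      (use prob_space_normal_density in \<open>auto intro!: prob_space_normal_density finite_measure.integrable_const prob_space.finite_measure\<close>)
  have bd: "\<bar>qterm b h x\<bar> ^ 3 \<le> (b ^ 3 * (1 + \<bar>h\<bar> ^ 3)) * g x" if b: "0 \<le> b" for b h x
  proof -
    have a1: "\<bar>x\<^sup>2 - 1\<bar> ^ 3 \<le> 4 * (x ^ 6 + 1)"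
      using abs_add_cube_le[of "x\<^sup>2" "-1"] by (simp add: power_mult[symmetric])
    have a2: "\<bar>2 * h * x\<bar> ^ 3 = 8 * (\<bar>h\<bar> ^ 3 * \<bar>x ^ 3\<bar>)"
      by (simp add: abs_mult power_mult_distrib power_abs)
    have "qterm b h x = b * ((x\<^sup>2 - 1) + 2 * h * x)"
      by (simp add: qterm_def power2_eq_square algebra_simps)
    then have "\<bar>qterm b h x\<bar> = b * \<bar>(x\<^sup>2 - 1) + 2 * h * x\<bar>"
      using b by (simp add: abs_mult)
    then have "\<bar>qterm b h x\<bar> ^ 3 = b ^ 3 * \<bar>(x\<^sup>2 - 1) + 2 * h * x\<bar> ^ 3"
      by (simp add: power_mult_distrib)
    also have "\<dots> \<le> b ^ 3 * (4 * (\<bar>x\<^sup>2 - 1\<bar> ^ 3 + \<bar>2 * h * x\<bar> ^ 3))"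
      using b by (intro mult_left_mono abs_add_cube_le) auto
    also have "\<dots> \<le> b ^ 3 * ((1 + \<bar>h\<bar> ^ 3) * g x)"
    proof (intro mult_left_mono)
      have p1: "0 \<le> \<bar>h\<bar> ^ 3 * (x ^ 6 + 1)" by auto
      have p2: "0 \<le> \<bar>x ^ 3\<bar>" by auto
      show "4 * (\<bar>x\<^sup>2 - 1\<bar> ^ 3 + \<bar>2 * h * x\<bar> ^ 3) \<le> (1 + \<bar>h\<bar> ^ 3) * g x"
      proof -
        have "(1 + \<bar>h\<bar> ^ 3) * g x = 16 * (x ^ 6 + 1) + 16 * (\<bar>h\<bar> ^ 3 * (x ^ 6 + 1))
            + 32 * \<bar>x ^ 3\<bar> + 32 * (\<bar>h\<bar> ^ 3 * \<bar>x ^ 3\<bar>)"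
          unfolding g_def by (simp add: algebra_simps)
        \<comment> \<open>Naming the products turns the comparison into a linear inequality.\<close>
        moreover have "4 * (A + B) \<le> G" if "G = 16 * P + 16 * Q + 32 * X + 32 * R" "A \<le> 4 * P"
          "B = 8 * R" "0 \<le> Q" "0 \<le> X" for A B G P Q X R :: real
          using that by simp
        ultimately show ?thesis using a1 a2 p1 p2 by metis
      qed
    qed (use b in auto)
    finally show ?thesis by (simp add: mult.assoc)
  qed
  have int: "integrable std_normal_distribution (\<lambda>x. \<bar>qterm b h x\<bar> ^ 3)" if "0 \<le> b" for b h
    by (rule Bochner_Integration.integrable_bound[OF integrable_mult_right[OF g, of "b ^ 3 * (1 + \<bar>h\<bar> ^ 3)"]])
      (use bd[OF that] in \<open>auto simp: qterm_def intro: order_trans[OF _ abs_ge_self]\<close>)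
  show thesis
  proof
    show "0 \<le> integral\<^sup>L std_normal_distribution g"
      by (intro integral_nonneg_AE AE_I2) (simp add: g_def)
    show "integrable std_normal_distribution (\<lambda>x. \<bar>qterm b h x\<bar> ^ 3)" if "0 \<le> b" for b h
      by (rule int[OF that])
    show "integral\<^sup>L std_normal_distribution (\<lambda>x. \<bar>qterm b h x\<bar> ^ 3)
       \<le> integral\<^sup>L std_normal_distribution g * (b ^ 3 * (1 + \<bar>h\<bar> ^ 3))" if b: "0 \<le> b" for b h
    proof -
      have "integral\<^sup>L std_normal_distribution (\<lambda>x. \<bar>qterm b h x\<bar> ^ 3)
         \<le> integral\<^sup>L std_normal_distribution (\<lambda>x. (b ^ 3 * (1 + \<bar>h\<bar> ^ 3)) * g x)"
        by (intro integral_mono int b integrable_mult_right g bd)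
      then show ?thesis by (simp add: mult.commute)
    qed
  qed
qed

text \<open>One estimate is the tangent line of the exponential; the other is its Taylor expansion,
  whose third-order remainder is nonpositive at the nonpositive argument \<open>- x\<close>.\<close>

lemma abs_exp_minus_approx: "\<bar>(1 - x) - exp (- x)\<bar> \<le> x\<^sup>2 / 2" if "0 \<le> x" for x :: real
proof -
  have "1 - x \<le> exp (- x)" using exp_ge_add_one_self[of "-x"] by simp
  moreover have "exp (- x) \<le> 1 - x + x\<^sup>2 / 2"
  proof -
    obtain u where u: "\<bar>u\<bar> \<le> \<bar>- x\<bar>" "exp (- x) = (\<Sum>m<3. (- x) ^ m / fact m) + exp u / fact 3 * (- x) ^ 3"
      using Maclaurin_exp_le[of "-x" 3] by auto
    have "exp u / fact 3 * (- x) ^ 3 \<le> 0" using that by (auto intro!: mult_nonneg_nonpos simp: power3_eq_cube mult_nonneg_nonneg)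
    moreover have "(\<Sum>m<3. (- x) ^ m / fact m) = 1 - x + x\<^sup>2 / 2"
      by (simp add: eval_nat_numeral)
    ultimately show ?thesis using u by linarith
  qed
  ultimately show ?thesis by auto
qed

text \<open>Two errors add up: the third-order expansion of the characteristic function of a centred
  variable of variance \<open>v\<close>, and the replacement of \<open>1 - t\<^sup>2 * v / 2\<close>
  by the Gaussian factor of the same variance, which multiplies well over coordinates.\<close>

lemma char_qterm_approx:
  assumes K: "integrable std_normal_distribution (\<lambda>x. \<bar>qterm b h x\<bar> ^ 3)"
    "integral\<^sup>L std_normal_distribution (\<lambda>x. \<bar>qterm b h x\<bar> ^ 3) \<le> G"
  defines "v \<equiv> b\<^sup>2 * (2 + 4 * h\<^sup>2)"
  shows "cmod (char (distr std_normal_distribution borel (qterm b h)) t - exp (- (t\<^sup>2 * v / 2)))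
    \<le> \<bar>t\<bar> ^ 3 / 6 * G + t ^ 4 / 8 * v\<^sup>2"
proof -
  interpret N: prob_space std_normal_distribution by (rule prob_space_normal_density) simp
  note m = qterm_moments[of b h]
  have v0: "0 \<le> v" by (simp add: v_def)
  have 1: "cmod (char (distr std_normal_distribution borel (qterm b h)) t - (1 - t\<^sup>2 * v / 2)) \<le>
    (t^2 / 6) * N.expectation (\<lambda>x. min (6 * (qterm b h x)^2) (\<bar>t\<bar> * \<bar>qterm b h x\<bar>^3))"
    by (rule N.char_approx3') (use m in \<open>auto simp: v_def\<close>)
  also have "\<dots> \<le> (t^2 / 6) * N.expectation (\<lambda>x. \<bar>t\<bar> * \<bar>qterm b h x\<bar>^3)"
    by (intro mult_left_mono integral_mono integrable_min integrable_mult_right m K) auto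
  also have "\<dots> \<le> (t^2 / 6) * (\<bar>t\<bar> * G)"
    using K(2) by (auto intro!: mult_left_mono)
  also have "\<dots> = \<bar>t\<bar> ^ 3 / 6 * G" by (simp add: power3_eq_cube power2_eq_square)
  finally have 1: "cmod (char (distr std_normal_distribution borel (qterm b h)) t - of_real (1 - t\<^sup>2 * v / 2)) \<le> \<bar>t\<bar> ^ 3 / 6 * G"
    by simp
  have "cmod (of_real (1 - t\<^sup>2 * v / 2) - of_real (exp (- (t\<^sup>2 * v / 2)))) \<le> (t\<^sup>2 * v / 2)\<^sup>2 / 2"
    unfolding of_real_diff[symmetric] norm_of_real
    using abs_exp_minus_approx[of "t\<^sup>2 * v / 2"] v0 by simp
  also have "\<dots> = t ^ 4 / 8 * v\<^sup>2" by (simp add: power2_eq_square power4_eq_xxxx)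
  finally show ?thesis
    using 1 norm_triangle_ineq[of "char (distr std_normal_distribution borel (qterm b h)) t - of_real (1 - t\<^sup>2 * v / 2)" "of_real (1 - t\<^sup>2 * v / 2) - complex_of_real (exp (- (t\<^sup>2 * v / 2)))"]
    by simp
qed

section \<open>A central limit theorem for weighted sums of noncentral squares\<close>

lemma char_noise_qterm_sum:
  "char (distr noise borel (\<lambda>\<xi>. \<Sum>i<N. qterm (b i) (h i) (\<xi> i))) t
    = (\<Prod>i<N. char (distr std_normal_distribution borel (qterm (b i) (h i))) t)"
proof -
  interpret noise: prob_space noise by (rule prob_space_noise)
  have "noise.indep_vars (\<lambda>_. borel) (\<lambda>i \<xi>. qterm (b i) (h i) (\<xi> i)) {..<N}"
    by (rule noise.indep_vars_compose2[where X="\<lambda>i \<xi>. \<xi> i" and M'="\<lambda>_. borel"])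
      (auto intro: noise.indep_vars_subset[OF indep_vars_noise])
  moreover have "distr noise borel (\<lambda>\<xi>. qterm (b i) (h i) (\<xi> i))
      = distr std_normal_distribution borel (qterm (b i) (h i))" for i
    unfolding distr_noise_component[of i, symmetric]
    by (subst distr_distr) (auto simp: comp_def)
  ultimately show ?thesis by (simp add: noise.char_distr_sum)
qed

text \<open>Used to bound error sums through a convergent series, uniformly in the number of
  terms.\<close>

lemma sum_le_suminf_bound:
  fixes f g :: "nat \<Rightarrow> real"
  assumes "summable g" "\<And>i. f i \<le> c * g i" "\<And>i. 0 \<le> g i" "0 \<le> c" "suminf g \<le> G"
  shows "(\<Sum>i<N. f i) \<le> c * G"
proof -
  have "(\<Sum>i<N. f i) \<le> (\<Sum>i<N. c * g i)" by (intro sum_mono assms)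
  also have "\<dots> = c * (\<Sum>i<N. g i)" by (simp add: sum_distrib_left)
  also have "\<dots> \<le> c * G"
    using sum_le_suminf[OF assms(1), of "{..<N}"] assms by (intro mult_left_mono) auto
  finally show ?thesis .
qed

text \<open>A Lyapunov-type estimate. The characteristic function of a partial sum is compared
  factor by factor with a product of Gaussian factors, uniformly in the number of terms, and the
  limit is taken afterwards. The normalization to one half makes the variance 1 when
  \<open>h = 0\<close>; the last summand of the bound accounts for the extra variance due to
  \<open>h\<close>. For fixed \<open>m\<close> and \<open>t\<close> the bound vanishes with
  \<open>\<beta>\<close>.\<close>

lemma char_quadratic_form_approx:
  obtains K :: real where
    "\<And>b h \<beta> m t W. (\<And>i. 0 \<le> b i) \<Longrightarrow> (\<And>i. b i \<le> \<beta>) \<Longrightarrow> summable (\<lambda>i. (b i)\<^sup>2)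
      \<Longrightarrow> (\<Sum>i. (b i)\<^sup>2) = 1 / 2 \<Longrightarrow> summable (\<lambda>i. b i * (h i)\<^sup>2) \<Longrightarrow> (\<Sum>i. b i * (h i)\<^sup>2) \<le> m
      \<Longrightarrow> W \<in> borel_measurable noise
      \<Longrightarrow> AE \<xi> in noise. (\<lambda>N. \<Sum>i<N. qterm (b i) (h i) (\<xi> i)) \<longlonglongrightarrow> W \<xi>
      \<Longrightarrow> cmod (char (distr noise borel W) t - exp (- (t\<^sup>2 / 2)))
        \<le> \<bar>t\<bar> ^ 3 / 6 * (K * (\<beta> / 2 + (\<beta> * sqrt (\<beta> * m)) * m))
          + t ^ 4 / 8 * ((2 * \<beta>\<^sup>2 + 4 * (\<beta> * m)) * (1 + 4 * (\<beta> * m)))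
          + t\<^sup>2 / 2 * (4 * (\<beta> * m))"
proof -
  obtain K where K: "0 \<le> K"
    "\<And>b h. 0 \<le> b \<Longrightarrow> integrable std_normal_distribution (\<lambda>x. \<bar>qterm b h x\<bar> ^ 3)"
    "\<And>b h. 0 \<le> b \<Longrightarrow> integral\<^sup>L std_normal_distribution (\<lambda>x. \<bar>qterm b h x\<bar> ^ 3) \<le> K * (b ^ 3 * (1 + \<bar>h\<bar> ^ 3))"
    using qterm_third_moment by metis
  show thesis
  proof (rule that[of K])
    fix b h :: "nat \<Rightarrow> real" and \<beta> m t :: real and W
    assume b0: "\<And>i. 0 \<le> b i" and b\<beta>: "\<And>i. b i \<le> \<beta>" and sb: "summable (\<lambda>i. (b i)\<^sup>2)"
      and b2: "(\<Sum>i. (b i)\<^sup>2) = 1 / 2" and sbh: "summable (\<lambda>i. b i * (h i)\<^sup>2)"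
      and m: "(\<Sum>i. b i * (h i)\<^sup>2) \<le> m" and W [measurable]: "W \<in> borel_measurable noise"
      and lim: "AE \<xi> in noise. (\<lambda>N. \<Sum>i<N. qterm (b i) (h i) (\<xi> i)) \<longlonglongrightarrow> W \<xi>"
    interpret noise: prob_space noise by (rule prob_space_noise)
    have \<beta>0: "0 \<le> \<beta>" using b0[of 0] b\<beta>[of 0] by simp
    have bh0: "0 \<le> b i * (h i)\<^sup>2" for i using b0 by simp
    have bhm: "b i * (h i)\<^sup>2 \<le> m" for i
      using sum_le_suminf[OF sbh, of "{i}"] bh0 m by auto
    have m0: "0 \<le> m" using bh0[of 0] bhm[of 0] by simp
    define v where "v i = (b i)\<^sup>2 * (2 + 4 * (h i)\<^sup>2)" for i
    have v0: "0 \<le> v i" for i by (simp add: v_def)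
    have bh2: "(b i)\<^sup>2 * (h i)\<^sup>2 \<le> \<beta> * (b i * (h i)\<^sup>2)" for i
      using mult_right_mono[OF b\<beta>[of i] bh0[of i]] by (simp add: power2_eq_square mult.assoc)
    \<comment> \<open>The cube splits into \<open>(b i)\<^sup>2 * (h i)\<^sup>2\<close> and one
      factor \<open>b i * \<bar>h i\<bar>\<close>; the latter is bounded by its maximum, the former
      by a multiple of the summable \<open>b i * (h i)\<^sup>2\<close>.\<close>
    have bh3: "b i ^ 3 * \<bar>h i\<bar> ^ 3 \<le> (\<beta> * sqrt (\<beta> * m)) * (b i * (h i)\<^sup>2)" for i
    proof -
      have "(b i * \<bar>h i\<bar>)\<^sup>2 \<le> \<beta> * m"
        using bh2[of i] mult_left_mono[OF bhm[of i] \<beta>0] by (simp add: power_mult_distrib)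
      then have "b i * \<bar>h i\<bar> \<le> sqrt (\<beta> * m)" by (rule real_le_rsqrt)
      then have "(b i)\<^sup>2 * (h i)\<^sup>2 * (b i * \<bar>h i\<bar>) \<le> (\<beta> * (b i * (h i)\<^sup>2)) * sqrt (\<beta> * m)"
        using mult_mono[OF bh2[of i], of "b i * \<bar>h i\<bar>" "sqrt (\<beta> * m)"] b0[of i] \<beta>0 by simp
      moreover have "(h i)\<^sup>2 = \<bar>h i\<bar>\<^sup>2" by simp
      ultimately show ?thesis by (simp add: power3_eq_cube power2_eq_square ac_simps)
    qed
    have svec: "summable v" and sumv: "suminf v \<le> 1 + 4 * (\<beta> * m)" "1 \<le> suminf v"
    proof -
      have s2: "summable (\<lambda>i. (b i)\<^sup>2 * (h i)\<^sup>2)"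
        by (rule summable_comparison_test'[OF summable_mult[OF sbh, of \<beta>], of 0]) (use bh2 in auto)
      have veq: "v = (\<lambda>i. 2 * (b i)\<^sup>2 + 4 * ((b i)\<^sup>2 * (h i)\<^sup>2))"
        by (auto simp: v_def algebra_simps)
      show "summable v" unfolding veq by (intro summable_add summable_mult sb s2)
      have sv: "suminf v = 1 + 4 * (\<Sum>i. (b i)\<^sup>2 * (h i)\<^sup>2)"
        unfolding veq using sb s2 b2
        by (simp add: suminf_add[symmetric] suminf_mult summable_mult)
      have "(\<Sum>i. (b i)\<^sup>2 * (h i)\<^sup>2) \<le> (\<Sum>i. \<beta> * (b i * (h i)\<^sup>2))"
        by (intro suminf_le bh2 s2 summable_mult sbh)
      also have "\<dots> \<le> \<beta> * m" using m \<beta>0 by (simp add: suminf_mult[OF sbh] mult_left_mono)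
      finally show "suminf v \<le> 1 + 4 * (\<beta> * m)" using sv by simp
      show "1 \<le> suminf v" using sv suminf_nonneg[OF s2] by simp
    qed
    have vmax: "(v i)\<^sup>2 \<le> (2 * \<beta>\<^sup>2 + 4 * (\<beta> * m)) * v i" for i
    proof -
      have "(b i)\<^sup>2 \<le> \<beta>\<^sup>2" using b0 b\<beta> by (intro power_mono) auto
      moreover have "(b i)\<^sup>2 * (h i)\<^sup>2 \<le> \<beta> * m"
        using bh2[of i] mult_left_mono[OF bhm[of i] \<beta>0] by simp
      ultimately have "v i \<le> 2 * \<beta>\<^sup>2 + 4 * (\<beta> * m)" by (simp add: v_def algebra_simps)
      from mult_right_mono[OF this v0] show ?thesis by (simp add: power2_eq_square)
    qed
    define E where "E = \<bar>t\<bar> ^ 3 / 6 * (K * (\<beta> / 2 + (\<beta> * sqrt (\<beta> * m)) * m))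
          + t ^ 4 / 8 * ((2 * \<beta>\<^sup>2 + 4 * (\<beta> * m)) * (1 + 4 * (\<beta> * m)))"
    have bound: "cmod (char (distr noise borel (\<lambda>\<xi>. \<Sum>i<N. qterm (b i) (h i) (\<xi> i))) t
        - exp (- (t\<^sup>2 * (\<Sum>i<N. v i) / 2))) \<le> E" for N
    proof -
      have "cmod (char (distr noise borel (\<lambda>\<xi>. \<Sum>i<N. qterm (b i) (h i) (\<xi> i))) t
          - exp (- (t\<^sup>2 * (\<Sum>i<N. v i) / 2)))
        = cmod ((\<Prod>i<N. char (distr std_normal_distribution borel (qterm (b i) (h i))) t)
            - (\<Prod>i<N. complex_of_real (exp (- (t\<^sup>2 * v i / 2)))))"
        unfolding char_noise_qterm_sum
        by (simp add: exp_sum[symmetric] of_real_prod[symmetric] sum_negf sum_divide_distrib sum_distrib_left del: of_real_prod)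
      \<comment> \<open>All factors have modulus at most 1, so the difference of the products is at
        most the sum of the differences.\<close>
      also have "\<dots> \<le> (\<Sum>i<N. cmod (char (distr std_normal_distribution borel (qterm (b i) (h i))) t
            - complex_of_real (exp (- (t\<^sup>2 * v i / 2)))))"
        by (intro norm_prod_diff real_distribution.cmod_char_le_1 prob_space.real_distribution_distr
            prob_space_normal_density) (auto simp: v0 norm_of_real simp del: of_real_exp)
      also have "\<dots> \<le> (\<Sum>i<N. \<bar>t\<bar> ^ 3 / 6 * (K * (b i ^ 3 * (1 + \<bar>h i\<bar> ^ 3))) + t ^ 4 / 8 * (v i)\<^sup>2)"
        unfolding v_def by (intro sum_mono char_qterm_approx K b0)
      also have "\<dots> = \<bar>t\<bar> ^ 3 / 6 * (K * ((\<Sum>i<N. b i ^ 3) + (\<Sum>i<N. b i ^ 3 * \<bar>h i\<bar> ^ 3)))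
            + t ^ 4 / 8 * (\<Sum>i<N. (v i)\<^sup>2)"
        by (simp add: sum.distrib sum_distrib_left algebra_simps)
      also have "\<dots> \<le> E" unfolding E_def
      proof (intro add_mono mult_left_mono K)
        have "b i ^ 3 \<le> \<beta> * (b i)\<^sup>2" for i
          using mult_right_mono[OF b\<beta>[of i], of "(b i)\<^sup>2"] by (simp add: power3_eq_cube power2_eq_square mult.assoc)
        from sum_le_suminf_bound[OF sb this, of "1 / 2"] b2 \<beta>0 show "(\<Sum>i<N. b i ^ 3) \<le> \<beta> / 2" by simp
        show "(\<Sum>i<N. b i ^ 3 * \<bar>h i\<bar> ^ 3) \<le> (\<beta> * sqrt (\<beta> * m)) * m"
          by (rule sum_le_suminf_bound[OF sbh bh3 bh0]) (use m \<beta>0 m0 in auto)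
        show "(\<Sum>i<N. (v i)\<^sup>2) \<le> (2 * \<beta>\<^sup>2 + 4 * (\<beta> * m)) * (1 + 4 * (\<beta> * m))"
          by (rule sum_le_suminf_bound[OF svec vmax v0 _ sumv(1)]) (use \<beta>0 m0 in auto)
      qed auto
      finally show ?thesis .
    qed
    \<comment> \<open>Almost sure convergence of the partial sums passes to characteristic functions
      by dominated convergence, the integrands having modulus 1.\<close>
    have "(\<lambda>N. char (distr noise borel (\<lambda>\<xi>. \<Sum>i<N. qterm (b i) (h i) (\<xi> i))) t)
        \<longlonglongrightarrow> char (distr noise borel W) t"
    proof -
      have "(\<lambda>N. \<integral>\<xi>. iexp (t * (\<Sum>i<N. qterm (b i) (h i) (\<xi> i))) \<partial>noise) \<longlonglongrightarrow> (\<integral>\<xi>. iexp (t * W \<xi>) \<partial>noise)"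
      proof (rule integral_dominated_convergence[where w="\<lambda>_. 1"])
        show "AE \<xi> in noise. (\<lambda>N. iexp (t * (\<Sum>i<N. qterm (b i) (h i) (\<xi> i)))) \<longlonglongrightarrow> iexp (t * W \<xi>)"
          using lim by eventually_elim (intro tendsto_intros)
      qed auto
      then show ?thesis by (simp add: char_def integral_distr)
    qed
    moreover have "(\<lambda>N. complex_of_real (exp (- (t\<^sup>2 * (\<Sum>i<N. v i) / 2)))) \<longlonglongrightarrow> complex_of_real (exp (- (t\<^sup>2 * suminf v / 2)))"
      by (intro tendsto_intros summable_LIMSEQ svec) auto
    ultimately have "cmod (char (distr noise borel W) t - complex_of_real (exp (- (t\<^sup>2 * suminf v / 2)))) \<le> E"
      by (intro Lim_bounded[OF tendsto_norm[OF tendsto_diff]]) (use bound in auto)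
    \<comment> \<open>The Gaussian of variance \<open>suminf v\<close> is replaced by the standard
      one; the excess variance enters through \<open>1 - exp (- d) \<le> d\<close>.\<close>
    moreover have "cmod (complex_of_real (exp (- (t\<^sup>2 * suminf v / 2))) - complex_of_real (exp (- (t\<^sup>2 / 2)))) \<le> t\<^sup>2 / 2 * (4 * (\<beta> * m))"
    proof -
      define d where "d = t\<^sup>2 / 2 * (suminf v - 1)"
      have d0: "0 \<le> d" using sumv by (simp add: d_def)
      have "exp (- (t\<^sup>2 * suminf v / 2)) = exp (- (t\<^sup>2 / 2)) * exp (- d)"
        by (simp add: d_def exp_add[symmetric] field_simps)
      then have "exp (- (t\<^sup>2 * suminf v / 2)) - exp (- (t\<^sup>2 / 2)) = exp (- (t\<^sup>2 / 2)) * (exp (- d) - 1)"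
        by (simp add: right_diff_distrib)
      then have "\<bar>exp (- (t\<^sup>2 * suminf v / 2)) - exp (- (t\<^sup>2 / 2))\<bar> = exp (- (t\<^sup>2 / 2)) * \<bar>exp (- d) - 1\<bar>"
        by (simp add: abs_mult)
      also have "\<dots> \<le> 1 * d"
        using d0 exp_ge_add_one_self[of "-d"] by (intro mult_mono) (auto simp: abs_if)
      also have "\<dots> \<le> t\<^sup>2 / 2 * (4 * (\<beta> * m))"
        unfolding d_def mult_1 using sumv by (intro mult_left_mono) auto
      finally show ?thesis unfolding of_real_diff[symmetric] norm_of_real by simp
    qed
    ultimately show "cmod (char (distr noise borel W) t - exp (- (t\<^sup>2 / 2)))
        \<le> \<bar>t\<bar> ^ 3 / 6 * (K * (\<beta> / 2 + (\<beta> * sqrt (\<beta> * m)) * m))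
          + t ^ 4 / 8 * ((2 * \<beta>\<^sup>2 + 4 * (\<beta> * m)) * (1 + 4 * (\<beta> * m)))
          + t\<^sup>2 / 2 * (4 * (\<beta> * m))"
      unfolding E_def[symmetric]
      using norm_triangle_ineq[of "char (distr noise borel W) t - complex_of_real (exp (- (t\<^sup>2 * suminf v / 2)))"
          "complex_of_real (exp (- (t\<^sup>2 * suminf v / 2))) - complex_of_real (exp (- (t\<^sup>2 / 2)))"] by simp
  qed
qed

text \<open>Every summand of the error bound has a factor that vanishes with \<open>\<beta>\<close>,
  while \<open>m\<close> is fixed; so the characteristic functions converge pointwise and Levy's
  continuity theorem applies.\<close>

lemma quadratic_form_clt:
  fixes b h :: "nat \<Rightarrow> nat \<Rightarrow> real"
  assumes good: "\<forall>\<^sub>F k in sequentially. (\<forall>i. 0 \<le> b k i \<and> b k i \<le> \<beta> k) \<and> summable (\<lambda>i. (b k i)\<^sup>2)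
      \<and> (\<Sum>i. (b k i)\<^sup>2) = 1 / 2 \<and> summable (\<lambda>i. b k i * (h k i)\<^sup>2) \<and> (\<Sum>i. b k i * (h k i)\<^sup>2) \<le> m
      \<and> (AE \<xi> in noise. (\<lambda>N. \<Sum>i<N. qterm (b k i) (h k i) (\<xi> i)) \<longlonglongrightarrow> W k \<xi>)"
    and W: "\<And>k. W k \<in> borel_measurable noise"
    and \<beta>: "\<beta> \<longlonglongrightarrow> 0"
  shows "weak_conv_m (\<lambda>k. distr noise borel (W k)) std_normal_distribution"
proof (rule levy_continuity)
  interpret noise: prob_space noise by (rule prob_space_noise)
  show "real_distribution (distr noise borel (W n))" for n
    by (rule noise.real_distribution_distr) (rule W)
  fix t :: real
  obtain K where K: "\<And>b h \<beta> m t W. (\<And>i. 0 \<le> b i) \<Longrightarrow> (\<And>i. b i \<le> \<beta>) \<Longrightarrow> summable (\<lambda>i. (b i)\<^sup>2)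
      \<Longrightarrow> (\<Sum>i. (b i)\<^sup>2) = 1 / 2 \<Longrightarrow> summable (\<lambda>i. b i * (h i)\<^sup>2) \<Longrightarrow> (\<Sum>i. b i * (h i)\<^sup>2) \<le> m
      \<Longrightarrow> W \<in> borel_measurable noise
      \<Longrightarrow> AE \<xi> in noise. (\<lambda>N. \<Sum>i<N. qterm (b i) (h i) (\<xi> i)) \<longlonglongrightarrow> W \<xi>
      \<Longrightarrow> cmod (char (distr noise borel W) t - exp (- (t\<^sup>2 / 2)))
        \<le> \<bar>t\<bar> ^ 3 / 6 * (K * (\<beta> / 2 + (\<beta> * sqrt (\<beta> * m)) * m))
          + t ^ 4 / 8 * ((2 * \<beta>\<^sup>2 + 4 * (\<beta> * m)) * (1 + 4 * (\<beta> * m)))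
          + t\<^sup>2 / 2 * (4 * (\<beta> * m))"
    by (rule char_quadratic_form_approx) blast
  let ?E = "\<lambda>k. \<bar>t\<bar> ^ 3 / 6 * (K * (\<beta> k / 2 + (\<beta> k * sqrt (\<beta> k * m)) * m))
          + t ^ 4 / 8 * ((2 * (\<beta> k)\<^sup>2 + 4 * (\<beta> k * m)) * (1 + 4 * (\<beta> k * m)))
          + t\<^sup>2 / 2 * (4 * (\<beta> k * m))"
  have "?E \<longlonglongrightarrow> \<bar>t\<bar> ^ 3 / 6 * (K * (0 / 2 + (0 * sqrt (0 * m)) * m))
          + t ^ 4 / 8 * ((2 * 0\<^sup>2 + 4 * (0 * m)) * (1 + 4 * (0 * m))) + t\<^sup>2 / 2 * (4 * (0 * m))"
    by (intro tendsto_intros \<beta>) auto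
  then have E: "?E \<longlonglongrightarrow> 0" by simp
  have "\<forall>\<^sub>F k in sequentially. cmod (char (distr noise borel (W k)) t - complex_of_real (exp (- (t\<^sup>2 / 2)))) \<le> ?E k"
    using good
  proof eventually_elim
    case (elim k)
    then show ?case
      by (intro K[of "b k" "\<beta> k" "h k"]) (auto simp: W)
  qed
  from Lim_null_comparison[OF this E]
  show "(\<lambda>k. char (distr noise borel (W k)) t) \<longlonglongrightarrow> char std_normal_distribution t"
    unfolding char_std_normal_distribution using Lim_null by fastforce
qed (rule real_dist_normal_dist)

section \<open>Uniform convergence to the normal distribution function\<close>

abbreviation Phi :: "real \<Rightarrow> real" where
  "Phi \<equiv> cdf std_normal_distribution"

lemma isCont_Phi: "isCont Phi x"
proof -
  interpret N: real_distribution std_normal_distribution by (rule real_dist_normal_dist)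
  have "emeasure std_normal_distribution {x} = 0"
    by (subst emeasure_density) (auto intro!: nn_integral_null_set)
  then show ?thesis by (simp add: N.isCont_cdf measure_def)
qed

text \<open>The density is positive, so an interval of zero mass would have zero length. Strictness
  later produces the strict bound on the type II error.\<close>

lemma Phi_strict_mono: "Phi x < Phi y" if "x < y"
proof -
  interpret N: real_distribution std_normal_distribution by (rule real_dist_normal_dist)
  have "emeasure std_normal_distribution {x<..y} \<noteq> 0"
  proof
    assume "emeasure std_normal_distribution {x<..y} = 0"
    then have "(\<integral>\<^sup>+u. ennreal (std_normal_density u) * indicator {x<..y} u \<partial>lborel) = 0"
      by (subst (asm) emeasure_density) auto
    then have "AE u in lborel. ennreal (std_normal_density u) * indicator {x<..y} u = 0"
      by (subst (asm) nn_integral_0_iff_AE) auto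
    then have "AE u in lborel. u \<notin> {x<..y}"
    proof eventually_elim
      case (elim u)
      have "0 < std_normal_density u" by (rule normal_density_pos) simp
      with elim show ?case by (auto simp: indicator_def ennreal_eq_0_iff split: if_splits)
    qed
    then have "emeasure lborel {x<..y} = 0"
      by (subst (asm) AE_iff_measurable[of "{x<..y}"]) auto
    with that show False by simp
  qed
  then have "0 < measure std_normal_distribution {x<..y}"
    by (simp add: N.emeasure_eq_measure zero_less_measure_iff)
  with N.cdf_diff_eq[OF that] show ?thesis by simp
qed

lemma Phi_less_iff: "Phi x < Phi y \<longleftrightarrow> x < y"
  using Phi_strict_mono by (metis linorder_neqE_linordered_idom not_less_iff_gr_or_eq)

lemma Phi_quantile:
  assumes "0 < p" "p < 1" obtains q where "Phi q = p"
proof -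
  interpret N: real_distribution std_normal_distribution by (rule real_dist_normal_dist)
  have "\<forall>\<^sub>F x in at_bot. Phi x < p" using N.cdf_lim_at_bot assms(1) by (rule order_tendstoD)
  then obtain a where a: "Phi a < p" by (auto simp: eventually_at_bot_linorder)
  have "\<forall>\<^sub>F x in at_top. p < Phi x" using N.cdf_lim_at_top_prob assms(2) by (rule order_tendstoD)
  then obtain b where b: "p < Phi b" by (auto simp: eventually_at_top_linorder)
  have "a \<le> b" using a b Phi_less_iff[of a b] by simp
  then show thesis
    using IVT[of Phi a p b] a b isCont_Phi that by auto
qed

text \<open>Polya's theorem. Quantiles of levels \<open>j / p\<close> cut the line into cells of
  small \<open>Phi\<close>-mass. By monotonicity, convergence at these finitely many points controls
  all of each cell between two of them; on the two unbounded cells the range of \<open>F k\<close>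
  supplies the missing bound.\<close>

lemma polya_uniform:
  fixes F :: "nat \<Rightarrow> real \<Rightarrow> real"
  assumes lim: "\<And>x. (\<lambda>k. F k x) \<longlonglongrightarrow> Phi x"
    and mono: "\<And>k x y. x \<le> y \<Longrightarrow> F k x \<le> F k y"
    and rng: "\<And>k x. 0 \<le> F k x" "\<And>k x. F k x \<le> 1"
  shows "uniform_limit UNIV F Phi sequentially"
proof (rule uniform_limitI)
  interpret N: real_distribution std_normal_distribution by (rule real_dist_normal_dist)
  fix e :: real assume e: "0 < e"
  \<comment> \<open>A cell has mass \<open>1 / p\<close>, less than half of \<open>e\<close>; the
    other half pays for the error at the grid points.\<close>
  obtain p :: nat where p: "2 / e < real p" using reals_Archimedean2 by blast
  then have p0: "0 < p" using e by (cases p) (auto simp: divide_less_0_iff)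
  have pe: "1 / real p < e / 2" using p e p0 by (simp add: field_simps)
  have "\<exists>q. Phi q = real j / real p" if "j \<in> {1..<p}" for j
    using Phi_quantile[of "real j / real p"] that by (auto simp: field_simps)
  then obtain q where q: "\<And>j. j \<in> {1..<p} \<Longrightarrow> Phi (q j) = real j / real p" by metis
  have "\<forall>\<^sub>F k in sequentially. \<forall>j\<in>{1..<p}. dist (F k (q j)) (Phi (q j)) < e / 2"
    by (intro eventually_ball_finite ballI tendstoD[OF lim]) (use e in auto)
  then show "\<forall>\<^sub>F k in sequentially. \<forall>x\<in>UNIV. dist (F k x) (Phi x) < e"
  proof eventually_elim
    case (elim k)
    show ?case
    proof
      fix x
      \<comment> \<open>\<open>j\<close> numbers the cell of \<open>x\<close> by mass:
        \<open>Phi x\<close> lies between \<open>j / p\<close> and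
        \<open>(j + 1) / p\<close>.\<close>
      define j where "j = nat \<lfloor>real p * Phi x\<rfloor>"
      have P: "0 \<le> Phi x" "Phi x \<le> 1" by (auto intro: N.cdf_nonneg N.cdf_bounded_prob)
      have j: "real j \<le> real p * Phi x" "real p * Phi x < real (Suc j)"
        unfolding j_def using P by (auto simp: floor_le_iff) linarith+
      have jp: "real j / real p \<le> Phi x" "Phi x < real j / real p + 1 / real p"
        using j p0 by (auto simp: pos_divide_le_eq pos_less_divide_eq mult.commute simp flip: add_divide_distrib)
      have lo: "Phi x - 1 / real p - e / 2 < F k x"
      proof (cases "j \<in> {1..<p}")
        case True
        have "Phi (q j) \<le> Phi x" unfolding q[OF True] using jp by (simp add: add_divide_distrib)
        then have "q j \<le> x" using Phi_less_iff[of x "q j"] by linarith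
        then have "F k (q j) \<le> F k x" by (rule mono)
        moreover have "Phi (q j) - e / 2 < F k (q j)" using bspec[OF elim True] unfolding dist_real_def by linarith
        moreover have "Phi x - 1 / real p < Phi (q j)" unfolding q[OF True] using jp by (simp add: add_divide_distrib)
        ultimately show ?thesis by linarith
      next
        case False
        show ?thesis
        proof (cases "j = 0")
          case True
          then have "Phi x < 1 / real p" using j(2) p0 by (simp add: field_simps)
          then show ?thesis using rng(1)[of k x] e by linarith
        next
          case F: False
          obtain x0 where x0: "x < x0" by (meson gt_ex)
          \<comment> \<open>This would force \<open>Phi x\<close> to be at least 1, which strict
            monotonicity excludes.\<close>
          have "p \<le> j" using False F by auto
          then have "real p \<le> real p * Phi x" using j(1) by linarith
          then have "1 \<le> Phi x" using p0 by simp
          with Phi_strict_mono[OF x0] N.cdf_bounded_prob[of x0] show ?thesis by linarith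
        qed
      qed
      have hi: "F k x < Phi x + 1 / real p + e / 2"
      proof (cases "Suc j \<in> {1..<p}")
        case True
        have "Phi x < Phi (q (Suc j))" unfolding q[OF True] using jp by (simp add: add_divide_distrib)
        then have "x \<le> q (Suc j)" using Phi_less_iff by force
        then have "F k x \<le> F k (q (Suc j))" by (rule mono)
        moreover have "F k (q (Suc j)) < Phi (q (Suc j)) + e / 2" using bspec[OF elim True] unfolding dist_real_def by linarith
        moreover have "Phi (q (Suc j)) \<le> Phi x + 1 / real p" unfolding q[OF True] using jp by (simp add: add_divide_distrib)
        ultimately show ?thesis by linarith
      next
        case False
        then have "real p \<le> real p * Phi x + 1" using j(1) by auto
        then have "1 \<le> Phi x + 1 / real p" using p0 by (simp add: field_simps)
        then show ?thesis using rng(2)[of k x] e by linarith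
      qed
      show "dist (F k x) (Phi x) < e" using lo hi pe by (simp add: dist_real_def abs_if)
    qed
  qed
qed

text \<open>The thresholds of a sequence of tests are arbitrary and may fail to converge; uniformity
  permits evaluation along any of them.\<close>

lemma uniform_limit_diff_along:
  fixes F :: "nat \<Rightarrow> real \<Rightarrow> real"
  assumes "uniform_limit UNIV F G sequentially"
  shows "(\<lambda>k. F k (t k) - G (t k)) \<longlonglongrightarrow> 0"
proof (rule tendstoI)
  fix e :: real assume "0 < e"
  from uniform_limitD[OF assms this]
  show "\<forall>\<^sub>F k in sequentially. dist (F k (t k) - G (t k)) 0 < e"
    by eventually_elim (auto simp: dist_real_def)
qed

text \<open>The shifted functions are again monotone with values in the unit interval, so pointwise
  convergence, a consequence of continuity, is upgraded by Polya's theorem.\<close>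

lemma Phi_shift_uniform:
  assumes m: "m \<longlonglongrightarrow> 0"
  shows "uniform_limit UNIV (\<lambda>k x. Phi (x - m k)) Phi sequentially"
proof (rule polya_uniform)
  interpret N: real_distribution std_normal_distribution by (rule real_dist_normal_dist)
  fix x y :: real and k :: nat
  have "(\<lambda>k. x - m k) \<longlonglongrightarrow> x - 0" by (intro tendsto_intros m)
  then show "(\<lambda>k. Phi (x - m k)) \<longlonglongrightarrow> Phi x"
    by (intro isCont_tendsto_compose[OF isCont_Phi]) simp
  show "x \<le> y \<Longrightarrow> Phi (x - m k) \<le> Phi (y - m k)" by (intro N.cdf_nondecreasing) simp
qed (auto intro: finite_borel_measure.cdf_nonneg real_distribution.cdf_bounded_prob
  real_distribution.finite_borel_measure_M real_dist_normal_dist)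

lemma weak_conv_std_normal_cdf:
  assumes "weak_conv_m (\<lambda>k. distr noise borel (W k)) std_normal_distribution"
    and W [measurable]: "\<And>k. W k \<in> borel_measurable noise"
  shows "(\<lambda>k. measure noise {\<xi> \<in> space noise. W k \<xi> \<le> x}) \<longlonglongrightarrow> Phi x"
proof -
  have "cdf (distr noise borel (W k)) x = measure noise {\<xi> \<in> space noise. W k \<xi> \<le> x}" for k
    unfolding cdf_def2 by (subst measure_distr) (auto intro!: arg_cong[where f="measure noise"])
  moreover have "(\<lambda>k. cdf (distr noise borel (W k)) x) \<longlonglongrightarrow> Phi x"
    using assms(1) isCont_Phi by (simp add: weak_conv_m_def weak_conv_def)
  ultimately show ?thesis by simp
qed

text \<open>\<open>1 - G k (t k)\<close> stands for the type I and \<open>F k (t k - m k)\<close>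
  for the type II error. Their sum is 1 up to three differences, each vanishing uniformly in the
  threshold.\<close>

lemma asymptotic_error_sum:
  fixes F G :: "nat \<Rightarrow> real \<Rightarrow> real"
  assumes "uniform_limit UNIV F Phi sequentially" "uniform_limit UNIV G Phi sequentially"
    and m: "m \<longlonglongrightarrow> 0"
  shows "(\<lambda>k. (1 - G k (t k)) + F k (t k - m k)) \<longlonglongrightarrow> 1"
proof -
  have "(\<lambda>k. 1 - (G k (t k) - Phi (t k)) + (F k (t k - m k) - Phi (t k - m k))
      + (Phi (t k - m k) - Phi (t k))) \<longlonglongrightarrow> 1 - 0 + 0 + 0"
    by (intro tendsto_intros uniform_limit_diff_along[OF assms(1)] uniform_limit_diff_along[OF assms(2)]
        uniform_limit_diff_along[OF Phi_shift_uniform[OF m]])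
  then show ?thesis by (simp add: algebra_simps)
qed

text \<open>With \<open>q\<close> the \<open>p\<close>-quantile, the thresholds are eventually at
  most \<open>q + c / 2\<close>. Subtracting a signal of at least \<open>c\<close> brings them to at
  most \<open>q - c / 2\<close>, where the limit is strictly below \<open>p\<close>.\<close>

lemma asymptotic_type_II_error:
  fixes F G :: "nat \<Rightarrow> real \<Rightarrow> real"
  assumes limF: "\<And>x. (\<lambda>k. F k x) \<longlonglongrightarrow> Phi x" and limG: "\<And>x. (\<lambda>k. G k x) \<longlonglongrightarrow> Phi x"
    and mono: "\<And>k x y. x \<le> y \<Longrightarrow> F k x \<le> F k y" "\<And>k x y. x \<le> y \<Longrightarrow> G k x \<le> G k y"
    and m: "\<forall>\<^sub>F k in sequentially. c \<le> m k" "0 < c"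
    and p: "0 < p" "p < 1" and t: "(\<lambda>k. G k (t k)) \<longlonglongrightarrow> p"
  shows "limsup (\<lambda>k. ereal (F k (t k - m k))) < ereal p"
proof -
  obtain q where q: "Phi q = p" using Phi_quantile p by metis
  have lt: "p < Phi (q + c / 2)" "Phi (q - c / 2) < p"
    using Phi_strict_mono[of q "q + c / 2"] Phi_strict_mono[of "q - c / 2" q] q m(2) by auto
  \<comment> \<open>\<open>z\<close> separates the limit of \<open>G k (t k)\<close> from the limit
    of \<open>G k\<close> at \<open>q + c / 2\<close>, so monotonicity bounds
    \<open>t k\<close>.\<close>
  then obtain z where z: "p < z" "z < Phi (q + c / 2)" using dense by blast
  have "\<forall>\<^sub>F k in sequentially. G k (t k) < z" using t z(1) by (rule order_tendstoD)
  moreover have "\<forall>\<^sub>F k in sequentially. z < G k (q + c / 2)" using limG z(2) by (rule order_tendstoD)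
  ultimately have "\<forall>\<^sub>F k in sequentially. ereal (F k (t k - m k)) \<le> ereal (F k (q - c / 2))"
    using m(1)
  proof eventually_elim
    case (elim k)
    then have "t k \<le> q + c / 2" using mono(2)[of "q + c / 2" "t k" k] by linarith
    then have "t k - m k \<le> q - c / 2" using elim m(2) by (simp add: field_simps)
    then show ?case by (simp add: mono)
  qed
  then have "limsup (\<lambda>k. ereal (F k (t k - m k))) \<le> limsup (\<lambda>k. ereal (F k (q - c / 2)))"
    by (rule Limsup_mono)
  also have "\<dots> = ereal (Phi (q - c / 2))"
    by (intro lim_imp_Limsup) (use limF in auto)
  finally show ?thesis using lt by (simp add: order.strict_trans1)
qed

section \<open>The standardized test statistic\<close>

lemma noise_integral_square:
  "(\<integral>\<^sup>+\<xi>. ennreal ((u + c * \<xi> i)\<^sup>2) \<partial>noise) = ennreal (u\<^sup>2 + c\<^sup>2)"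
proof -
  interpret N: prob_space std_normal_distribution by (rule prob_space_normal_density) simp
  have eq: "(\<lambda>x. (u + c * x)\<^sup>2) = (\<lambda>x. u\<^sup>2 + (2 * u * c) * x + c\<^sup>2 * x\<^sup>2)"
    by (auto simp: power2_eq_square algebra_simps)
  have "(\<integral>\<^sup>+\<xi>. ennreal ((u + c * \<xi> i)\<^sup>2) \<partial>noise)
      = (\<integral>\<^sup>+x. ennreal ((u + c * x)\<^sup>2) \<partial>distr noise borel (\<lambda>\<xi>. \<xi> i))"
    by (subst nn_integral_distr) auto
  also have "\<dots> = (\<integral>\<^sup>+x. ennreal ((u + c * x)\<^sup>2) \<partial>std_normal_distribution)"
    by (simp only: distr_noise_component)
  also have "\<dots> = ennreal (integral\<^sup>L std_normal_distribution (\<lambda>x. (u + c * x)\<^sup>2))"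
    by (rule nn_integral_eq_integral) (auto simp: eq)
  also have "integral\<^sup>L std_normal_distribution (\<lambda>x. (u + c * x)\<^sup>2) = u\<^sup>2 + c\<^sup>2"
    unfolding eq by (simp add: std_normal_moments N.prob_space[simplified])
  finally show ?thesis .
qed

text \<open>By Tonelli the series of nonnegative terms has finite expectation, hence is finite
  almost surely. This gives the \<open>suminf\<close> inside \<open>Tstat\<close> its
  meaning.\<close>

lemma AE_summable_noise:
  fixes a th :: "nat \<Rightarrow> real"
  assumes a: "\<And>i. 0 \<le> a i" "summable a" and th: "summable (\<lambda>i. a i * (th i)\<^sup>2)"
  shows "AE \<xi> in noise. summable (\<lambda>i. a i * (th i + c * \<xi> i)\<^sup>2)"
proof -
  have "(\<integral>\<^sup>+\<xi>. (\<Sum>i. ennreal (a i * (th i + c * \<xi> i)\<^sup>2)) \<partial>noise)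
      = (\<Sum>i. \<integral>\<^sup>+\<xi>. ennreal (a i * (th i + c * \<xi> i)\<^sup>2) \<partial>noise)"
    by (rule nn_integral_suminf) simp
  also have "\<dots> = (\<Sum>i. ennreal (a i * (th i)\<^sup>2 + c\<^sup>2 * a i))"
  proof (rule suminf_cong)
    fix i
    have "(\<integral>\<^sup>+\<xi>. ennreal (a i * (th i + c * \<xi> i)\<^sup>2) \<partial>noise)
        = (\<integral>\<^sup>+\<xi>. ennreal (a i) * ennreal ((th i + c * \<xi> i)\<^sup>2) \<partial>noise)"
      by (simp add: ennreal_mult a)
    also have "\<dots> = ennreal (a i) * ennreal ((th i)\<^sup>2 + c\<^sup>2)"
      by (subst nn_integral_cmult) (auto simp: noise_integral_square)
    also have "\<dots> = ennreal (a i * (th i)\<^sup>2 + c\<^sup>2 * a i)"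
      by (simp add: ennreal_mult[symmetric] a algebra_simps)
    finally show "(\<integral>\<^sup>+\<xi>. ennreal (a i * (th i + c * \<xi> i)\<^sup>2) \<partial>noise) = ennreal (a i * (th i)\<^sup>2 + c\<^sup>2 * a i)" .
  qed
  also have "\<dots> \<noteq> \<infinity>"
    using summable_add[OF th summable_mult[OF a(2), of "c\<^sup>2"]] a
    by (subst suminf_ennreal2) auto
  finally have "AE \<xi> in noise. (\<Sum>i. ennreal (a i * (th i + c * \<xi> i)\<^sup>2)) \<noteq> \<infinity>"
    by (intro nn_integral_PInf_AE) auto
  then show ?thesis
    by eventually_elim (rule summable_suminf_not_top, use a in auto)
qed

text \<open>The standard deviation of \<open>Tstat\<close> under the hypothesis; as
  \<open>kap\<close> holds squared weights, the sum is one of fourth powers.\<close>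

definition null_scale :: "(nat \<Rightarrow> nat \<Rightarrow> real) \<Rightarrow> real \<Rightarrow> nat \<Rightarrow> real" where
  "null_scale kap \<sigma> n = \<sigma>\<^sup>2 / real n * sqrt (2 * (\<Sum>i. (kap n i)\<^sup>2))"

definition signal :: "(nat \<Rightarrow> nat \<Rightarrow> real) \<Rightarrow> real \<Rightarrow> nat \<Rightarrow> (nat \<Rightarrow> real) \<Rightarrow> real" where
  "signal kap \<sigma> n th = (\<Sum>i. kap n i * (th i)\<^sup>2) / null_scale kap \<sigma> n"

text \<open>Centring by the signal gives hypothesis and alternative the same limit
  \<open>Phi\<close>; the signal then appears only as a shift of the threshold.\<close>

definition std_cdf :: "(nat \<Rightarrow> nat \<Rightarrow> real) \<Rightarrow> real \<Rightarrow> nat \<Rightarrow> (nat \<Rightarrow> real) \<Rightarrow> real \<Rightarrow> real" where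
  "std_cdf kap \<sigma> n th x = measure noise
     {\<xi> \<in> space noise. Tstat kap \<sigma> n th \<xi> / null_scale kap \<sigma> n - signal kap \<sigma> n th \<le> x}"

lemma Tstat_measurable [measurable]: "Tstat kap \<sigma> n th \<in> borel_measurable noise"
  unfolding Tstat_def by measurable

lemma std_cdf_mono: "x \<le> y \<Longrightarrow> std_cdf kap \<sigma> n th x \<le> std_cdf kap \<sigma> n th y"
  unfolding std_cdf_def
  by (intro finite_measure.finite_measure_mono prob_space.finite_measure prob_space_noise) auto

lemma std_cdf_range: "0 \<le> std_cdf kap \<sigma> n th x" "std_cdf kap \<sigma> n th x \<le> 1"
  unfolding std_cdf_def by (auto intro: prob_space.prob_le_1 prob_space_noise)

lemma beta_err_eq_std_cdf:
  assumes "0 < null_scale kap \<sigma> n"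
  shows "beta_err kap \<sigma> n t th = std_cdf kap \<sigma> n th (t / null_scale kap \<sigma> n - signal kap \<sigma> n th)"
  unfolding beta_err_def std_cdf_def using assms by (simp add: divide_le_cancel)

lemma alpha_err_eq_std_cdf:
  assumes "0 < null_scale kap \<sigma> n"
  shows "alpha_err kap \<sigma> n t = 1 - std_cdf kap \<sigma> n (\<lambda>_. 0) (t / null_scale kap \<sigma> n)"
proof -
  interpret noise: prob_space noise by (rule prob_space_noise)
  have "alpha_err kap \<sigma> n t = 1 - beta_err kap \<sigma> n t (\<lambda>_. 0)"
    unfolding alpha_err_def beta_err_def
    using noise.prob_neg[of "\<lambda>\<xi>. Tstat kap \<sigma> n (\<lambda>_. 0) \<xi> \<le> t"] by (simp add: not_le)
  then show ?thesis using assms by (simp add: beta_err_eq_std_cdf signal_def)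
qed

lemma decreasing_summable_square:
  fixes k th :: "nat \<Rightarrow> real"
  assumes "\<And>i. 0 \<le> k i" "\<And>i j. i \<le> j \<Longrightarrow> k j \<le> k i"
  shows "summable k \<Longrightarrow> summable (\<lambda>i. (k i)\<^sup>2)"
    and "th \<in> l2 \<Longrightarrow> summable (\<lambda>i. k i * (th i)\<^sup>2)"
proof -
  show "summable (\<lambda>i. (k i)\<^sup>2)" if "summable k"
    by (rule summable_comparison_test'[OF summable_mult[OF that, of "k 0"], of 0])
      (use assms in \<open>auto simp: power2_eq_square intro!: mult_right_mono\<close>)
  show "summable (\<lambda>i. k i * (th i)\<^sup>2)" if "th \<in> l2"
    by (rule summable_comparison_test'[OF summable_mult[of "\<lambda>i. (th i)\<^sup>2" "k 0"], of 0])
      (use assms that in \<open>auto simp: l2_def abs_mult intro!: mult_right_mono\<close>)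
qed

text \<open>As the weights decrease, the first normalized weight is the largest, so
  \<open>neg\<close> is the negligibility of single coordinates that the limit theorem asks
  for.\<close>

lemma std_cdf_tendsto_Phi:
  assumes sigma: "0 < \<sigma>" and nonneg: "\<And>n i. 0 \<le> kap n i" and summ: "\<And>n. summable (kap n)"
    and decr: "\<And>n i j. i \<le> j \<Longrightarrow> kap n j \<le> kap n i"
    and ns: "\<forall>\<^sub>F k in sequentially. 1 \<le> ns k \<and> 0 < (\<Sum>i. (kap (ns k) i)\<^sup>2)"
    and fs: "\<And>k. fs k \<in> l2" "\<forall>\<^sub>F k in sequentially. signal kap \<sigma> (ns k) (fs k) \<le> m"
    and neg: "(\<lambda>k. kap (ns k) 0 / sqrt (2 * (\<Sum>i. (kap (ns k) i)\<^sup>2))) \<longlonglongrightarrow> 0"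
  shows "(\<lambda>k. std_cdf kap \<sigma> (ns k) (fs k) x) \<longlonglongrightarrow> Phi x"
  unfolding std_cdf_def
proof (rule weak_conv_std_normal_cdf)
  show "(\<lambda>\<xi>. Tstat kap \<sigma> (ns k) (fs k) \<xi> / null_scale kap \<sigma> (ns k) - signal kap \<sigma> (ns k) (fs k)) \<in> borel_measurable noise" for k
    by measurable
  define S where "S n = sqrt (2 * (\<Sum>i. (kap n i)\<^sup>2))" for n
  define b where "b k i = kap (ns k) i / S (ns k)" for k i
  define h where "h k i = fs k i * sqrt (real (ns k)) / \<sigma>" for k i
  show "weak_conv_m (\<lambda>k. distr noise borel (\<lambda>\<xi>. Tstat kap \<sigma> (ns k) (fs k) \<xi> / null_scale kap \<sigma> (ns k) - signal kap \<sigma> (ns k) (fs k))) std_normal_distribution"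
  proof (rule quadratic_form_clt[where b=b and h=h and \<beta>="\<lambda>k. b k 0" and m=m])
    show "(\<lambda>k. b k 0) \<longlonglongrightarrow> 0" using neg by (simp add: b_def S_def)
    show "\<forall>\<^sub>F k in sequentially. (\<forall>i. 0 \<le> b k i \<and> b k i \<le> b k 0) \<and> summable (\<lambda>i. (b k i)\<^sup>2)
      \<and> (\<Sum>i. (b k i)\<^sup>2) = 1 / 2 \<and> summable (\<lambda>i. b k i * (h k i)\<^sup>2) \<and> (\<Sum>i. b k i * (h k i)\<^sup>2) \<le> m
      \<and> (AE \<xi> in noise. (\<lambda>N. \<Sum>i<N. qterm (b k i) (h k i) (\<xi> i)) \<longlonglongrightarrow>
        Tstat kap \<sigma> (ns k) (fs k) \<xi> / null_scale kap \<sigma> (ns k) - signal kap \<sigma> (ns k) (fs k))"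
      using ns fs(2)
    proof eventually_elim
      case (elim k)
      define n where "n = ns k"
      have n: "1 \<le> n" "0 < (\<Sum>i. (kap n i)\<^sup>2)" and sg: "signal kap \<sigma> n (fs k) \<le> m"
        using elim by (auto simp: n_def)
      have S: "0 < S n" "(S n)\<^sup>2 = 2 * (\<Sum>i. (kap n i)\<^sup>2)" using n by (auto simp: S_def)
      note sk = decreasing_summable_square[of "kap n", OF nonneg decr]
      have s2: "summable (\<lambda>i. (kap n i)\<^sup>2)" and sf: "summable (\<lambda>i. kap n i * (fs k i)\<^sup>2)"
        using sk summ fs(1) by auto
      have b2: "(\<lambda>i. (b k i)\<^sup>2) = (\<lambda>i. (kap n i)\<^sup>2 / (S n)\<^sup>2)"
        by (auto simp: b_def n_def power_divide)
      have sc: "null_scale kap \<sigma> n = \<sigma>\<^sup>2 / real n * S n" by (simp add: null_scale_def S_def)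
      have bh: "b k i * (h k i)\<^sup>2 = kap n i * (fs k i)\<^sup>2 / null_scale kap \<sigma> n" for i
        unfolding sc b_def h_def n_def[symmetric] using n by (simp add: power_divide power_mult_distrib ac_simps)
      \<comment> \<open>Factoring the noise level \<open>\<sigma> / sqrt (real n)\<close> out of the
        observation identifies a coordinate of the standardized statistic with a
        \<open>qterm\<close>.\<close>
      have qt: "qterm (b k i) (h k i) y =
          (kap n i * (fs k i + \<sigma> / sqrt (real n) * y)\<^sup>2 - \<sigma>\<^sup>2 / real n * kap n i - kap n i * (fs k i)\<^sup>2)
           / null_scale kap \<sigma> n" for i y
      proof -
        have r: "sqrt (real n) * sqrt (real n) = real n" "0 < sqrt (real n)" using n by auto
        have "fs k i + \<sigma> / sqrt (real n) * y = (\<sigma> / sqrt (real n)) * (h k i + y)"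
          using sigma r by (simp add: h_def n_def field_simps)
        then have e1: "(fs k i + \<sigma> / sqrt (real n) * y)\<^sup>2 = \<sigma>\<^sup>2 / real n * (h k i + y)\<^sup>2"
          using n by (simp add: power_mult_distrib power_divide)
        have e2: "(fs k i)\<^sup>2 = \<sigma>\<^sup>2 / real n * (h k i)\<^sup>2"
          using sigma n by (simp add: h_def n_def power_divide power_mult_distrib)
        show ?thesis unfolding e1 unfolding e2 qterm_def sc b_def n_def[symmetric]
          using sigma n S by (simp add: field_simps)
      qed
      have "(AE \<xi> in noise. (\<lambda>N. \<Sum>i<N. qterm (b k i) (h k i) (\<xi> i)) \<longlonglongrightarrow>
        Tstat kap \<sigma> n (fs k) \<xi> / null_scale kap \<sigma> n - signal kap \<sigma> n (fs k))"
        using AE_summable_noise[of "kap n" "fs k" "\<sigma> / sqrt (real n)", OF nonneg summ sf]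
      proof eventually_elim
        case (elim \<xi>)
        have "(\<lambda>i. qterm (b k i) (h k i) (\<xi> i)) sums
           (((\<Sum>i. kap n i * (fs k i + \<sigma> / sqrt (real n) * \<xi> i)\<^sup>2) - \<sigma>\<^sup>2 / real n * rho kap n
              - (\<Sum>i. kap n i * (fs k i)\<^sup>2)) / null_scale kap \<sigma> n)"
          unfolding qt rho_def
          by (intro sums_divide sums_diff sums_mult summable_sums elim sf summ)
        then show ?case by (simp add: sums_def Tstat_def signal_def diff_divide_distrib)
      qed
      moreover have "(\<Sum>i. (b k i)\<^sup>2) = 1 / 2"
        unfolding b2 using n by (simp add: suminf_divide[OF s2] S)
      moreover have "(\<Sum>i. b k i * (h k i)\<^sup>2) \<le> m"
        unfolding bh using sg by (simp add: suminf_divide[OF sf] signal_def)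
      moreover have "summable (\<lambda>i. (b k i)\<^sup>2)" "summable (\<lambda>i. b k i * (h k i)\<^sup>2)"
        unfolding b2 bh by (intro summable_divide s2 sf)+
      moreover have "0 \<le> b k i" "b k i \<le> b k 0" for i
        using S nonneg decr by (auto simp: b_def n_def intro!: divide_right_mono)
      ultimately show ?case by (auto simp: n_def)
    qed
  qed measurable
qed

section \<open>Tails and Besov balls\<close>

text \<open>The cut compares with \<open>Suc i\<close> because position \<open>i\<close> holds the
  coefficient of index \<open>i + 1\<close>.\<close>

definition tail :: "(nat \<Rightarrow> real) \<Rightarrow> real \<Rightarrow> nat \<Rightarrow> real" where
  "tail th lam = (\<lambda>i. if lam < real (Suc i) then th i else 0)"

lemma tail_sq: "(\<lambda>i. (tail th lam i)\<^sup>2) = (\<lambda>i. if real (Suc i) > lam then (th i)\<^sup>2 else 0)"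
  by (auto simp: tail_def)

lemma tail_summable: "summable (\<lambda>i. (tail th lam i)\<^sup>2)" if "th \<in> l2"
  by (rule summable_comparison_test'[of "\<lambda>i. (th i)\<^sup>2" 0]) (use that in \<open>auto simp: l2_def tail_def\<close>)

lemma besov_ball_alt:
  "besov_ball s P0 = {th \<in> l2. \<forall>lam>0. lam powr (2 * s) * (\<Sum>i. (tail th lam i)\<^sup>2) \<le> P0}"
  unfolding besov_ball_def tail_sq ..

lemma l2norm_sq: "(l2norm th)\<^sup>2 = (\<Sum>i. (th i)\<^sup>2)" if "th \<in> l2"
  using that by (simp add: l2norm_def l2_def suminf_nonneg)

lemma l2norm_nonneg: "0 \<le> l2norm th" if "th \<in> l2"
  using that by (simp add: l2norm_def l2_def suminf_nonneg)

lemma suminf_tail_le: "(\<Sum>i. (tail th lam i)\<^sup>2) \<le> (\<Sum>i. (th i)\<^sup>2)" if "th \<in> l2"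
  by (rule suminf_le) (use that tail_summable[OF that] in \<open>auto simp: tail_def l2_def\<close>)

lemma suminf_tail_nonneg: "0 \<le> (\<Sum>i. (tail th lam i)\<^sup>2)" if "th \<in> l2"
  by (intro suminf_nonneg tail_summable that) simp

lemma tail_tendsto_zero:
  assumes "th \<in> l2"
  shows "(\<lambda>N. \<Sum>i. (tail th (real N) i)\<^sup>2) \<longlonglongrightarrow> 0"
proof -
  have s: "summable (\<lambda>i. (th i)\<^sup>2)" using assms by (simp add: l2_def)
  have "(\<Sum>i. (tail th (real N) i)\<^sup>2) = (\<Sum>i. (th (i + N))\<^sup>2)" for N
  proof -
    have "(\<Sum>i. (tail th (real N) i)\<^sup>2) = (\<Sum>i. (tail th (real N) (i + N))\<^sup>2) + (\<Sum>i<N. (tail th (real N) i)\<^sup>2)"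
      by (rule suminf_split_initial_segment[OF tail_summable[OF assms]])
    then show ?thesis by (simp add: tail_def)
  qed
  moreover have "(\<lambda>N. \<Sum>i. (th (i + N))\<^sup>2) \<longlonglongrightarrow> 0"
    using suminf_exist_split2[OF s] by simp
  ultimately show ?thesis by simp
qed

lemma tail_antimono:
  assumes "th \<in> l2" "l \<le> l'"
  shows "(\<Sum>i. (tail th l' i)\<^sup>2) \<le> (\<Sum>i. (tail th l i)\<^sup>2)"
proof (rule suminf_le)
  show "(tail th l' i)\<^sup>2 \<le> (tail th l i)\<^sup>2" for i using assms(2) by (auto simp: tail_def)
qed (intro tail_summable assms(1))+

section \<open>Besov balls as bounded, closed, convex, ortho-symmetric sets\<close>

lemma besov_ball_bounded: "l2bounded (besov_ball s P0)"
  unfolding l2bounded_def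
proof (intro exI ballI)
  fix th assume "th \<in> besov_ball s P0"
  then have th: "th \<in> l2" "(1 / 2) powr (2 * s) * (\<Sum>i. (tail th (1 / 2) i)\<^sup>2) \<le> P0"
    unfolding besov_ball_alt by (auto dest!: spec[of _ "1 / 2"])
  \<comment> \<open>Indices start at 1, so the constraint at \<open>1 / 2\<close> covers the whole
    sequence.\<close>
  have "tail th (1 / 2) = th" by (auto simp: tail_def)
  with th(2) have "(\<Sum>i. (th i)\<^sup>2) \<le> P0 / (1 / 2) powr (2 * s)"
    by (simp add: field_simps)
  then show "l2norm th \<le> sqrt (P0 / (1 / 2) powr (2 * s))" by (simp add: l2norm_def)
qed

lemma besov_ball_ortho_symmetric: "ortho_symmetric (besov_ball s P0)"
proof -
  have e: "(\<lambda>i. (tail (\<lambda>i. if sg i then th i else - th i) lam i)\<^sup>2) = (\<lambda>i. (tail th lam i)\<^sup>2)" for sg th lam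
    by (auto simp: tail_def)
  have e': "(\<lambda>i. (if sg i then th i else - th i)\<^sup>2) = (\<lambda>i. (th i)\<^sup>2)" for sg and th :: "nat \<Rightarrow> real"
    by auto
  show ?thesis
    unfolding ortho_symmetric_def besov_ball_alt l2_def mem_Collect_eq e e' by blast
qed

lemma convex_square_sum:
  fixes x y :: "nat \<Rightarrow> real"
  assumes "summable (\<lambda>i. (x i)\<^sup>2)" "summable (\<lambda>i. (y i)\<^sup>2)" "0 \<le> u" "u \<le> 1"
  shows "summable (\<lambda>i. (u * x i + (1 - u) * y i)\<^sup>2)"
    and "(\<Sum>i. (u * x i + (1 - u) * y i)\<^sup>2) \<le> u * (\<Sum>i. (x i)\<^sup>2) + (1 - u) * (\<Sum>i. (y i)\<^sup>2)"
proof -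
  have le: "(u * x i + (1 - u) * y i)\<^sup>2 \<le> u * (x i)\<^sup>2 + (1 - u) * (y i)\<^sup>2" for i
  proof -
    have "u * (x i)\<^sup>2 + (1 - u) * (y i)\<^sup>2 - (u * x i + (1 - u) * y i)\<^sup>2 = u * (1 - u) * (x i - y i)\<^sup>2"
      by (simp add: power2_eq_square algebra_simps)
    moreover have "0 \<le> u * (1 - u) * (x i - y i)\<^sup>2" using assms by simp
    ultimately show ?thesis by linarith
  qed
  have s: "summable (\<lambda>i. u * (x i)\<^sup>2 + (1 - u) * (y i)\<^sup>2)"
    by (intro summable_add summable_mult assms)
  show s': "summable (\<lambda>i. (u * x i + (1 - u) * y i)\<^sup>2)"
    by (rule summable_comparison_test'[OF s, of 0]) (use le in auto)
  show "(\<Sum>i. (u * x i + (1 - u) * y i)\<^sup>2) \<le> u * (\<Sum>i. (x i)\<^sup>2) + (1 - u) * (\<Sum>i. (y i)\<^sup>2)"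
    using suminf_le[OF le s' s] assms
    by (simp add: suminf_add[symmetric] suminf_mult summable_mult)
qed

lemma besov_ball_convex: "l2convex (besov_ball s P0)"
  unfolding l2convex_def
proof (intro ballI allI impI)
  fix x y and u :: real
  assume x: "x \<in> besov_ball s P0" and y: "y \<in> besov_ball s P0" and u: "0 \<le> u \<and> u \<le> 1"
  have l2: "x \<in> l2" "y \<in> l2" using x y by (auto simp: besov_ball_alt)
  let ?z = "\<lambda>i. u * x i + (1 - u) * y i"
  show "?z \<in> besov_ball s P0" unfolding besov_ball_alt
  proof (intro CollectI conjI allI impI)
    show "?z \<in> l2" using convex_square_sum(1)[of x y u] l2 u by (simp add: l2_def)
    fix lam :: real assume lam: "0 < lam"
    have "tail ?z lam = (\<lambda>i. u * tail x lam i + (1 - u) * tail y lam i)" by (auto simp: tail_def)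
    then have "(\<Sum>i. (tail ?z lam i)\<^sup>2) \<le> u * (\<Sum>i. (tail x lam i)\<^sup>2) + (1 - u) * (\<Sum>i. (tail y lam i)\<^sup>2)"
      using convex_square_sum(2)[OF tail_summable[OF l2(1)] tail_summable[OF l2(2)]] u by simp
    then have "lam powr (2 * s) * (\<Sum>i. (tail ?z lam i)\<^sup>2)
        \<le> lam powr (2 * s) * (u * (\<Sum>i. (tail x lam i)\<^sup>2) + (1 - u) * (\<Sum>i. (tail y lam i)\<^sup>2))"
      by (rule mult_left_mono) simp
    also have "\<dots> = u * (lam powr (2 * s) * (\<Sum>i. (tail x lam i)\<^sup>2)) + (1 - u) * (lam powr (2 * s) * (\<Sum>i. (tail y lam i)\<^sup>2))"
      by (simp add: algebra_simps)
    also have "\<dots> \<le> u * P0 + (1 - u) * P0"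
      using x y u lam by (intro add_mono mult_left_mono) (auto simp: besov_ball_alt)
    finally show "lam powr (2 * s) * (\<Sum>i. (tail ?z lam i)\<^sup>2) \<le> P0" by (simp add: algebra_simps)
  qed
qed

lemma l2_tendsto_coordinate:
  assumes "\<And>m. x m \<in> l2" "th \<in> l2" "(\<lambda>m. l2norm (\<lambda>i. x m i - th i)) \<longlonglongrightarrow> 0"
  shows "(\<lambda>m. x m i) \<longlonglongrightarrow> th i"
proof -
  have "\<bar>x m i - th i\<bar> \<le> l2norm (\<lambda>i. x m i - th i)" for m
  proof -
    \<comment> \<open>The difference is written as the midpoint of \<open>2 * x m i\<close> and
      \<open>- 2 * th i\<close>, so that the convexity lemma yields summability.\<close>
    have "summable (\<lambda>i. (1 / 2 * (2 * x m i) + (1 - 1 / 2) * (- 2 * th i))\<^sup>2)"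
      using assms(1)[of m] assms(2)
      by (intro convex_square_sum) (auto simp: l2_def power_mult_distrib intro!: summable_mult)
    then have "summable (\<lambda>i. (x m i - th i)\<^sup>2)" by simp
    from sum_le_suminf[OF this, of "{i}"] have "(x m i - th i)\<^sup>2 \<le> (\<Sum>i. (x m i - th i)\<^sup>2)" by simp
    then show ?thesis unfolding l2norm_def by (intro real_le_rsqrt) simp
  qed
  then have "(\<lambda>m. x m i - th i) \<longlonglongrightarrow> 0"
    by (intro Lim_null_comparison[OF _ assms(3)]) auto
  then show ?thesis by (rule LIM_zero_cancel)
qed

text \<open>Norm convergence gives convergence of the coordinates, hence of each finite partial sum
  of a tail. The bound passes to these partial sums and from them to the series.\<close>

lemma besov_ball_closed: "l2closed (besov_ball s P0)"
  unfolding l2closed_def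
proof (intro allI ballI impI)
  fix x :: "nat \<Rightarrow> nat \<Rightarrow> real" and th
  assume th: "th \<in> l2" and x: "(\<forall>m. x m \<in> besov_ball s P0) \<and> (\<lambda>m. l2norm (\<lambda>i. x m i - th i)) \<longlonglongrightarrow> 0"
  have xl2: "x m \<in> l2" for m using x by (auto simp: besov_ball_alt)
  have co: "(\<lambda>m. x m i) \<longlonglongrightarrow> th i" for i
    using l2_tendsto_coordinate[OF xl2 th] x by auto
  show "th \<in> besov_ball s P0" unfolding besov_ball_alt
  proof (intro CollectI conjI allI impI th)
    fix lam :: real assume lam: "0 < lam"
    have p: "0 < lam powr (2 * s)" using lam by simp
    have "(\<Sum>i<N. (tail th lam i)\<^sup>2) \<le> P0 / lam powr (2 * s)" for N
    proof (rule LIMSEQ_le_const2)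
      show "(\<lambda>m. \<Sum>i<N. (tail (x m) lam i)\<^sup>2) \<longlonglongrightarrow> (\<Sum>i<N. (tail th lam i)\<^sup>2)"
      proof (intro tendsto_intros)
        show "(\<lambda>m. tail (x m) lam i) \<longlonglongrightarrow> tail th lam i" for i
          using co[of i] by (simp add: tail_def)
      qed
      have "(\<Sum>i<N. (tail (x m) lam i)\<^sup>2) \<le> P0 / lam powr (2 * s)" for m
      proof -
        have "(\<Sum>i<N. (tail (x m) lam i)\<^sup>2) \<le> (\<Sum>i. (tail (x m) lam i)\<^sup>2)"
          by (intro sum_le_suminf tail_summable xl2) auto
        also have "\<dots> \<le> P0 / lam powr (2 * s)"
          using x lam p by (auto simp: besov_ball_alt field_simps)
        finally show ?thesis .
      qed
      then show "\<exists>M. \<forall>m\<ge>M. (\<Sum>i<N. (tail (x m) lam i)\<^sup>2) \<le> P0 / lam powr (2 * s)" by blast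
    qed
    then have "(\<Sum>i. (tail th lam i)\<^sup>2) \<le> P0 / lam powr (2 * s)"
      by (intro suminf_le_const tail_summable th)
    then show "lam powr (2 * s) * (\<Sum>i. (tail th lam i)\<^sup>2) \<le> P0" using p by (simp add: field_simps)
  qed
qed

text \<open>The tail is the midpoint of \<open>f\<close> and its copy with the signs of the head
  flipped.\<close>

lemma tail_in_convex_ortho_symmetric:
  assumes "l2convex V" "ortho_symmetric V" "f \<in> V"
  shows "tail f lam \<in> V"
proof -
  let ?g = "\<lambda>i. if lam < real (Suc i) then f i else - f i"
  have "?g \<in> V"
    using assms(2,3) unfolding ortho_symmetric_def
    by (elim ballE[of _ _ f] allE[of _ "\<lambda>i. lam < real (Suc i)"]) auto
  then have "(\<lambda>i. 1 / 2 * f i + (1 - 1 / 2) * ?g i) \<in> V"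
    using assms(1,3) unfolding l2convex_def
    by (elim ballE[of _ _ f] ballE[of _ _ ?g] allE[of _ "1 / 2"]) auto
  moreover have "(\<lambda>i. 1 / 2 * f i + (1 - 1 / 2) * ?g i) = tail f lam"
    by (auto simp: tail_def)
  ultimately show ?thesis by simp
qed

text \<open>Outside the space every positive multiple of \<open>f\<close> violates the inequality of
  the ball at some \<open>lam\<close>. Dividing by a large \<open>g\<close> pushes this
  \<open>lam\<close> beyond \<open>B'\<close>, since up to \<open>B'\<close> the total norm of
  \<open>f\<close> keeps the product at most \<open>Q\<close>.\<close>

lemma large_tail_outside_span:
  assumes f: "f \<in> l2" "f \<notin> span_space (besov_ball s P0)" and s: "0 < s" and P0: "0 < P0"
    and B: "0 < B" and \<epsilon>: "0 < \<epsilon>"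
  obtains lam where "B < lam" "B < lam powr (2 * s) * (\<Sum>i. (tail f lam i)\<^sup>2)" "(\<Sum>i. (tail f lam i)\<^sup>2) < \<epsilon>"
proof -
  have "\<forall>\<^sub>F N in sequentially. (\<Sum>i. (tail f (real N) i)\<^sup>2) < \<epsilon>"
    using tail_tendsto_zero[OF f(1)] \<epsilon> by (rule order_tendstoD)
  then obtain N where N: "(\<Sum>i. (tail f (real N) i)\<^sup>2) < \<epsilon>" by (auto simp: eventually_sequentially)
  \<comment> \<open>Beyond \<open>N\<close> the tail is smaller than \<open>\<epsilon>\<close>;
    beyond \<open>B\<close> the first claim holds.\<close>
  define B' where "B' = max B (real N)"
  define Q where "Q = max B (B' powr (2 * s) * (\<Sum>i. (f i)\<^sup>2))"
  have B': "0 < B'" using B by (simp add: B'_def)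
  have Q: "0 < Q" using B by (simp add: Q_def)
  define g where "g = sqrt (Q / P0)"
  have g: "0 < g" "g\<^sup>2 = Q / P0" using Q P0 by (auto simp: g_def)
  have "(\<lambda>i. f i / g) \<notin> besov_ball s P0"
  proof
    assume "(\<lambda>i. f i / g) \<in> besov_ball s P0"
    then have "(\<lambda>i. g * (f i / g)) \<in> span_space (besov_ball s P0)"
      unfolding span_space_def using g(1) by (intro UN_I[of g] image_eqI[of _ _ "\<lambda>i. f i / g"]) auto
    with f(2) g show False by simp
  qed
  moreover have "(\<lambda>i. f i / g) \<in> l2"
    using f(1) by (auto simp: l2_def power_divide intro: summable_divide)
  ultimately obtain lam where lam: "0 < lam" "P0 < lam powr (2 * s) * (\<Sum>i. (tail (\<lambda>i. f i / g) lam i)\<^sup>2)"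
    unfolding besov_ball_alt by (auto simp: not_le)
  have "(\<lambda>i. (tail (\<lambda>i. f i / g) lam i)\<^sup>2) = (\<lambda>i. (tail f lam i)\<^sup>2 / g\<^sup>2)"
    by (auto simp: tail_def power_divide)
  then have "(\<Sum>i. (tail (\<lambda>i. f i / g) lam i)\<^sup>2) = (\<Sum>i. (tail f lam i)\<^sup>2) / g\<^sup>2"
    using suminf_divide[OF tail_summable[OF f(1)]] by simp
  with lam(2) have QL: "Q < lam powr (2 * s) * (\<Sum>i. (tail f lam i)\<^sup>2)"
    using Q P0 unfolding g(2) by (simp add: field_simps)
  have "B' < lam"
  proof (rule ccontr)
    assume "\<not> B' < lam"
    then have "lam powr (2 * s) * (\<Sum>i. (tail f lam i)\<^sup>2) \<le> B' powr (2 * s) * (\<Sum>i. (f i)\<^sup>2)"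
      using lam(1) s f(1) by (intro mult_mono powr_mono2 suminf_tail_le suminf_tail_nonneg) auto
    with QL show False by (simp add: Q_def)
  qed
  show thesis
  proof (rule that[of lam])
    show "B < lam" using \<open>B' < lam\<close> by (simp add: B'_def)
    show "B < lam powr (2 * s) * (\<Sum>i. (tail f lam i)\<^sup>2)" using QL by (simp add: Q_def)
    have "real N \<le> lam" using \<open>B' < lam\<close> by (simp add: B'_def)
    with tail_antimono[OF f(1)] N show "(\<Sum>i. (tail f lam i)\<^sup>2) < \<epsilon>" by (meson order.strict_trans1)
  qed
qed

section \<open>Size of the weights and of the signal\<close>

text \<open>Partial sums eventually exceed half of \<open>rho\<close>, so the supremum in
  \<open>kn\<close> is a maximum. Monotonicity then compares the first \<open>kn\<close> weights, or
  their squares, with \<open>kn\<close> copies of the smallest or largest one.\<close>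

lemma kn_bounds:
  assumes nonneg: "\<And>i. 0 \<le> kap n i" and summ: "summable (kap n)"
    and decr: "\<And>i j. i \<le> j \<Longrightarrow> kap n j \<le> kap n i" and rho: "0 < rho kap n"
  shows "1 \<le> kn kap n" and "real (kn kap n) * kapn kap n \<le> rho kap n"
    and "rho kap n / 2 < real (kn kap n) * kap n 0"
    and "real (kn kap n) * (kapn kap n)\<^sup>2 \<le> (\<Sum>i. (kap n i)\<^sup>2)"
proof -
  define A where "A = {k. 1 \<le> k \<and> (\<Sum>j\<in>{1..<k}. kw kap n j) \<le> rho kap n / 2}"
  \<comment> \<open>Indices from 1 up to \<open>m\<close> are the first \<open>m\<close>
    positions.\<close>
  have sm: "(\<Sum>j\<in>{1..<Suc m}. kw kap n j) = (\<Sum>i<m. kap n i)" for m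
    by (induction m) (auto simp: kw_def)
  have "(\<lambda>m. \<Sum>i<m. kap n i) \<longlonglongrightarrow> rho kap n" unfolding rho_def by (rule summable_LIMSEQ[OF summ])
  then have "\<forall>\<^sub>F m in sequentially. rho kap n / 2 < (\<Sum>i<m. kap n i)"
    by (rule order_tendstoD) (use rho in auto)
  then obtain M where M: "\<And>m. M \<le> m \<Longrightarrow> rho kap n / 2 < (\<Sum>i<m. kap n i)"
    by (auto simp: eventually_sequentially)
  have "A \<subseteq> {..M}"
  proof
    fix k assume k: "k \<in> A"
    then obtain m where m: "k = Suc m" by (cases k) (auto simp: A_def)
    have "(\<Sum>i<m. kap n i) \<le> rho kap n / 2"
      using k unfolding A_def m mem_Collect_eq sm by simp
    then have "\<not> M \<le> m" using M[of m] by linarith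
    then show "k \<in> {..M}" using m by simp
  qed
  then have fin: "finite A" by (rule finite_subset) simp
  have "1 \<in> A" using rho by (simp add: A_def)
  have kn: "kn kap n = Max A" unfolding kn_def A_def[symmetric]
    using fin \<open>1 \<in> A\<close> by (intro cSup_eq_Max) auto
  have in_A: "kn kap n \<in> A" unfolding kn using fin \<open>1 \<in> A\<close> by (intro Max_in) auto
  then show "1 \<le> kn kap n" by (simp add: A_def)
  then obtain m where m: "kn kap n = Suc m" by (cases "kn kap n") auto
  \<comment> \<open>The candidate after the maximum fails, so the first \<open>kn\<close> weights
    sum to more than half of \<open>rho\<close>.\<close>
  have "Suc (Suc m) \<notin> A" using Max_ge[OF fin, of "Suc (Suc m)"] kn m by auto
  then have gt: "rho kap n / 2 < (\<Sum>i<Suc m. kap n i)" by (simp only: A_def sm mem_Collect_eq) auto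
  also have "\<dots> \<le> (\<Sum>i<Suc m. kap n 0)" by (intro sum_mono decr) simp
  finally show "rho kap n / 2 < real (kn kap n) * kap n 0" by (simp add: m)
  have kapn: "kapn kap n = kap n m" by (simp add: kapn_def kw_def m)
  have "(\<Sum>i<Suc m. kap n m) \<le> (\<Sum>i<Suc m. kap n i)" by (intro sum_mono decr) simp
  also have "\<dots> \<le> rho kap n" unfolding rho_def by (intro sum_le_suminf summ nonneg) auto
  finally show "real (kn kap n) * kapn kap n \<le> rho kap n" by (simp add: kapn m)
  have "(\<Sum>i<Suc m. (kap n m)\<^sup>2) \<le> (\<Sum>i<Suc m. (kap n i)\<^sup>2)"
    by (intro sum_mono power_mono decr nonneg) simp
  also have "\<dots> \<le> (\<Sum>i. (kap n i)\<^sup>2)"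
    by (intro sum_le_suminf decreasing_summable_square(1)[OF nonneg decr summ]) auto
  finally show "real (kn kap n) * (kapn kap n)\<^sup>2 \<le> (\<Sum>i. (kap n i)\<^sup>2)" by (simp add: kapn m)
qed

text \<open>The orders of the weights, of the squared norm on the shell and of the inverse null
  scale cancel; this keeps signals on the shell bounded.\<close>

lemma shell_powr_product:
  "N powr (2 * r - 2) * N powr (- r) * N powr (- r) * N powr 2 = 1" if "0 < N" for N r :: real
proof -
  have "N powr (2 * r - 2) * N powr (- r) * N powr (- r) * N powr 2 = N powr (2 * r - 2 + - r + - r + 2)"
    by (simp only: powr_add)
  then show ?thesis using that by simp
qed

section \<open>Exact orders of the weights under the assumptions\<close>

locale quadratic_test =
  fixes kap :: "nat \<Rightarrow> nat \<Rightarrow> real" and \<sigma> r s :: real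
  assumes sigma: "0 < \<sigma>"
    and r: "0 < r" "r < 1/2"
    and s: "s = r / (2 - 4 * r)"
    and nonneg: "\<And>n i. 0 \<le> kap n i"
    and summ: "\<And>n. summable (kap n)"
    and A1: "\<And>n i j. i \<le> j \<Longrightarrow> kap n j \<le> kap n i"
    and A2: "\<exists>C1 C2. 0 < C1 \<and> (\<forall>n\<ge>1. C1 < real n ^ 2 / \<sigma> ^ 4 * (\<Sum>i. (kap n i)\<^sup>2)
                                   \<and> real n ^ 2 / \<sigma> ^ 4 * (\<Sum>i. (kap n i)\<^sup>2) < C2)"
    and A3: "\<exists>c1 c2. 0 < c1 \<and> 0 < c2 \<and> (\<forall>n\<ge>1. c1 * real n powr (-2 * r) \<le> rho kap n
                                   \<and> rho kap n \<le> c2 * real n powr (-2 * r))"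
    and A4: "\<exists>C1 lam. 0 < C1 \<and> 1 < lam \<and> (\<forall>\<delta>>0. \<forall>n\<ge>1.
               kapat kap n (1 + \<delta>) < C1 * (1 + \<delta>) powr (- lam) * kapn kap n)"
    and A5a: "\<exists>c C. 0 < c \<and> 0 < C \<and> (\<forall>n\<ge>1. c * kapn kap n \<le> kw kap n 1 \<and> kw kap n 1 \<le> C * kapn kap n)"
    and A5b: "\<And>c. 1 < c \<Longrightarrow> \<exists>C>0. \<forall>n\<ge>1. kapat kap n c \<ge> C * kapn kap n"
begin

lemma s_pos: "0 < s" using r s by simp

text \<open>First, \<open>n powr (2 - 4 * r)\<close>, the order of \<open>kn\<close>, raised to
  \<open>2 * s\<close> is \<open>n powr (2 * r)\<close>. Second, for
  \<open>n = e powr (- 1 / r)\<close> that order becomes \<open>e powr (- 1 / s)\<close>.\<close>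

lemma s_exponents: "(2 - 4 * r) * (2 * s) = 2 * r" "(2 - 4 * r) / r = 1 / s"
  using r s by auto

text \<open>With \<open>\<kappa>\<close>, \<open>q\<close> and \<open>R\<close> for
  \<open>kapn\<close>, \<open>kn\<close> and the order of \<open>rho\<close>, A3 and A5 make
  \<open>q * \<kappa>\<close> of order \<open>R\<close>. By A2 the sum of squares has order
  \<open>1 / N\<^sup>2\<close>, and it lies between \<open>q * \<kappa>\<^sup>2\<close> and the
  first weight times \<open>rho\<close>. So \<open>\<kappa>\<close> is of order
  \<open>1 / (R * N\<^sup>2)\<close>, and division gives \<open>q\<close> the order
  \<open>R\<^sup>2 * N\<^sup>2\<close>.\<close>

lemma weight_scale:
  obtains d D where "0 < d" "0 < D"
    "\<And>n. 1 \<le> n \<Longrightarrow> d * real n powr (2 * r - 2) \<le> kapn kap n"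
    "\<And>n. 1 \<le> n \<Longrightarrow> kapn kap n \<le> D * real n powr (2 * r - 2)"
    "\<And>n. 1 \<le> n \<Longrightarrow> kap n 0 \<le> D * real n powr (2 * r - 2)"
    "\<And>n. 1 \<le> n \<Longrightarrow> d * real n powr (2 - 4 * r) \<le> real (kn kap n)"
    "\<And>n. 1 \<le> n \<Longrightarrow> real (kn kap n) \<le> D * real n powr (2 - 4 * r)"
    "\<And>n. 1 \<le> n \<Longrightarrow> d / real n \<le> sqrt (2 * (\<Sum>i. (kap n i)\<^sup>2))"
    "\<And>n. 1 \<le> n \<Longrightarrow> sqrt (2 * (\<Sum>i. (kap n i)\<^sup>2)) \<le> D / real n"
    "\<And>n. 1 \<le> n \<Longrightarrow> 1 \<le> kn kap n"
proof -
  obtain a A where "0 < a" and aA: "\<And>n. 1 \<le> n \<Longrightarrow> a < real n ^ 2 / \<sigma> ^ 4 * (\<Sum>i. (kap n i)\<^sup>2)"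
     "\<And>n. 1 \<le> n \<Longrightarrow> real n ^ 2 / \<sigma> ^ 4 * (\<Sum>i. (kap n i)\<^sup>2) < A" using A2 by blast
  obtain c1 c2 where c: "0 < c1" "0 < c2" and rho: "\<And>n. 1 \<le> n \<Longrightarrow> c1 * real n powr (-2 * r) \<le> rho kap n"
     "\<And>n. 1 \<le> n \<Longrightarrow> rho kap n \<le> c2 * real n powr (-2 * r)" using A3 by blast
  obtain C where C: "0 < C" "\<And>n. 1 \<le> n \<Longrightarrow> kap n 0 \<le> C * kapn kap n"
    using A5a by (auto simp: kw_def)
  define a' where "a' = a * \<sigma> ^ 4" define A' where "A' = A * \<sigma> ^ 4"
  have "0 < A" using aA[of 1] \<open>0 < a\<close> by linarith
  then have pos: "0 < a'" "0 < A'" using \<open>0 < a\<close> sigma by (auto simp: a'_def A'_def)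
  \<comment> \<open>\<open>l\<close> and \<open>L\<close> will bound
    \<open>\<kappa> * (R * N\<^sup>2)\<close> from below and above; \<open>d\<close> and
    \<open>D\<close> merge all constants into one pair.\<close>
  define l where "l = a' / (C * c2)" define L where "L = 2 * C * A' / c1"
  have lL: "0 < l" "0 < L" using pos c C by (auto simp: l_def L_def)
  define d where "d = min l (min (c1 / (2 * C * L)) (sqrt (2 * a')))"
  define D where "D = L + C * L + c2 / l + sqrt (2 * A')"
  have "0 < C * L" "0 < c2 / l" "0 < sqrt (2 * A')" "0 < c1 / (2 * C * L)" "0 < sqrt (2 * a')"
    using lL pos c C by auto
  then have "0 < D" unfolding D_def using lL by linarith
  have dD: "d \<le> l" "d \<le> c1 / (2 * C * L)" "d \<le> sqrt (2 * a')" "0 < d"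
    using lL \<open>0 < c1 / (2 * C * L)\<close> \<open>0 < sqrt (2 * a')\<close>
    unfolding d_def by simp_all
  have DD: "L \<le> D" "C * L \<le> D" "c2 / l \<le> D" "sqrt (2 * A') \<le> D" 
    using lL \<open>0 < C * L\<close> \<open>0 < c2 / l\<close> \<open>0 < sqrt (2 * A')\<close>
    unfolding D_def by linarith+
  {
    fix n :: nat assume n: "1 \<le> n"
    define N where "N = real n"
    define R where "R = N powr (-2 * r)"
    define \<Sigma> where "\<Sigma> = (\<Sum>i. (kap n i)\<^sup>2)"
    define \<kappa> where "\<kappa> = kapn kap n"
    define q where "q = real (kn kap n)"
    have N: "0 < N" using n by (simp add: N_def)
    have R: "0 < R" using N by (simp add: R_def)
    have rho': "c1 * R \<le> rho kap n" "rho kap n \<le> c2 * R" using rho[OF n] by (auto simp: R_def N_def)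
    have rho0: "0 < rho kap n" using rho' c R by (meson less_le_trans mult_pos_pos)
    note kb = kn_bounds[of kap n, OF nonneg summ A1 rho0]
    have \<Sigma>: "a' < N\<^sup>2 * \<Sigma>" "N\<^sup>2 * \<Sigma> < A'"
      using aA[OF n] sigma by (auto simp: a'_def A'_def N_def \<Sigma>_def field_simps)
    have e1: "N powr (2 * r - 2) = 1 / (R * N\<^sup>2)"
      using N by (simp add: R_def powr_diff powr_minus divide_simps powr_numeral)
    have e2: "N powr (2 - 4 * r) = R\<^sup>2 * N\<^sup>2"
    proof -
      have "R\<^sup>2 * N\<^sup>2 = N powr (-2 * r) * N powr (-2 * r) * N powr 2"
        using N by (simp add: R_def power2_eq_square powr_numeral)
      also have "\<dots> = N powr (2 - 4 * r)" by (simp flip: powr_add)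
      finally show ?thesis by simp
    qed
    have k0: "kap n 0 \<le> C * \<kappa>" using C(2)[OF n] by (simp add: \<kappa>_def)
    have q1: "1 \<le> q" using kb(1) by (simp add: q_def)
    have qk: "q * \<kappa> \<le> c2 * R" using kb(2) rho' by (simp add: q_def \<kappa>_def)
    have qk2: "c1 * R \<le> 2 * C * (q * \<kappa>)"
    proof -
      have "c1 * R / 2 \<le> q * kap n 0" using kb(3) rho' by (simp add: q_def)
      also have "\<dots> \<le> q * (C * \<kappa>)" using k0 q1 by (intro mult_left_mono) auto
      finally show ?thesis by (simp add: ac_simps)
    qed
    have "0 < c1 * R" using c R by simp
    then have "0 < 2 * C * (q * \<kappa>)" using qk2 by linarith
    then have \<kappa>0: "0 < \<kappa>" using C q1 by (simp add: zero_less_mult_iff)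
    \<comment> \<open>Multiplying the lower bound on \<open>q * \<kappa>\<close> by
      \<open>\<kappa>\<close> produces \<open>q * \<kappa>\<^sup>2\<close>, which the sum of squares
      dominates.\<close>
    have up: "\<kappa> * (R * N\<^sup>2) \<le> L"
    proof -
      have "c1 * R * \<kappa> \<le> 2 * C * (q * \<kappa>) * \<kappa>" using qk2 \<kappa>0 by (intro mult_right_mono) auto
      also have "\<dots> = 2 * C * (q * \<kappa>\<^sup>2)" by (simp add: power2_eq_square)
      also have "\<dots> \<le> 2 * C * \<Sigma>" using kb(4) C by (simp add: q_def \<kappa>_def \<Sigma>_def)
      finally have "c1 * R * \<kappa> * N\<^sup>2 \<le> 2 * C * \<Sigma> * N\<^sup>2" by (rule mult_right_mono) simp
      also have "\<dots> = 2 * C * (N\<^sup>2 * \<Sigma>)" by simp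
      also have "\<dots> \<le> 2 * C * A'" using \<Sigma>(2) C by simp
      finally show ?thesis using c by (simp add: L_def field_simps)
    qed
    \<comment> \<open>The sum of squares is at most the first weight times \<open>rho\<close>, and
      the first weight is at most \<open>C * \<kappa>\<close>.\<close>
    have lo: "l \<le> \<kappa> * (R * N\<^sup>2)"
    proof -
      have s2: "summable (\<lambda>i. (kap n i)\<^sup>2)" by (rule decreasing_summable_square(1)[OF nonneg A1 summ])
      have "\<Sigma> \<le> (\<Sum>i. kap n 0 * kap n i)" unfolding \<Sigma>_def
        by (intro suminf_le s2 summable_mult summ) (auto simp: power2_eq_square intro!: mult_right_mono A1 nonneg)
      also have "\<dots> = kap n 0 * rho kap n" by (simp add: rho_def suminf_mult[OF summ])
      also have "\<dots> \<le> (C * \<kappa>) * (c2 * R)" using k0 rho' rho0 C \<kappa>0 by (intro mult_mono) auto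
      finally have "N\<^sup>2 * \<Sigma> \<le> N\<^sup>2 * ((C * \<kappa>) * (c2 * R))" by (rule mult_left_mono) simp
      then have "a' \<le> N\<^sup>2 * ((C * \<kappa>) * (c2 * R))" using \<Sigma>(1) by linarith
      then show ?thesis using C c by (simp add: l_def field_simps)
    qed
    have RN: "0 < R * N\<^sup>2" using R N by simp
    have 1: "l * N powr (2 * r - 2) \<le> \<kappa>" "\<kappa> \<le> L * N powr (2 * r - 2)"
      unfolding e1 using up lo RN by (simp_all add: pos_divide_le_eq pos_le_divide_eq)
    have "C * \<kappa> \<le> C * (L * N powr (2 * r - 2))" using 1 C by simp
    then have 2: "kap n 0 \<le> C * L * N powr (2 * r - 2)" using k0 by (simp add: mult.assoc)
    have 3: "q \<le> c2 / l * N powr (2 - 4 * r)"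
    proof -
      have "q * l \<le> q * (\<kappa> * (R * N\<^sup>2))" using lo q1 by simp
      also have "\<dots> = (q * \<kappa>) * (R * N\<^sup>2)" by simp
      also have "\<dots> \<le> (c2 * R) * (R * N\<^sup>2)" using qk RN by (intro mult_right_mono) auto
      finally show ?thesis unfolding e2 using lL by (simp add: field_simps power2_eq_square)
    qed
    have 4: "c1 / (2 * C * L) * N powr (2 - 4 * r) \<le> q"
    proof -
      have "c1 * R * (R * N\<^sup>2) \<le> 2 * C * (q * \<kappa>) * (R * N\<^sup>2)" using qk2 RN by (intro mult_right_mono) auto
      also have "\<dots> = 2 * C * q * (\<kappa> * (R * N\<^sup>2))" by simp
      also have "\<dots> \<le> 2 * C * q * L" using up C q1 by (intro mult_left_mono) auto
      finally show ?thesis unfolding e2 using lL C by (simp add: field_simps power2_eq_square)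
    qed
    have 5: "sqrt (2 * \<Sigma>) = sqrt (2 * (N\<^sup>2 * \<Sigma>)) / N"
      using N by (simp add: real_sqrt_mult)
    have 6: "sqrt (2 * a') / N \<le> sqrt (2 * \<Sigma>)" "sqrt (2 * \<Sigma>) \<le> sqrt (2 * A') / N"
      unfolding 5 using \<Sigma> N by (auto intro!: divide_right_mono)
    have z: "0 \<le> N powr (2 * r - 2)" "0 \<le> N powr (2 - 4 * r)" by auto
    have "d * N powr (2 * r - 2) \<le> \<kappa>" "\<kappa> \<le> D * N powr (2 * r - 2)" "kap n 0 \<le> D * N powr (2 * r - 2)"
      "d * N powr (2 - 4 * r) \<le> q" "q \<le> D * N powr (2 - 4 * r)" "d / N \<le> sqrt (2 * \<Sigma>)" "sqrt (2 * \<Sigma>) \<le> D / N"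
      using mult_right_mono[OF dD(1) z(1)] mult_right_mono[OF DD(1) z(1)] mult_right_mono[OF DD(2) z(1)]
        mult_right_mono[OF dD(2) z(2)] mult_right_mono[OF DD(3) z(2)]
        divide_right_mono[OF dD(3), of N] divide_right_mono[OF DD(4), of N] N 1 2 3 4 6
      by linarith+
    note this[unfolded N_def \<Sigma>_def \<kappa>_def q_def] kb(1)
  }
  with dD(4) \<open>0 < D\<close> show thesis by (rule that)
qed


lemma null_scale_bounds:
  obtains d D where "0 < d" "0 < D"
    "\<And>n. 1 \<le> n \<Longrightarrow> d / (real n)\<^sup>2 \<le> null_scale kap \<sigma> n"
    "\<And>n. 1 \<le> n \<Longrightarrow> null_scale kap \<sigma> n \<le> D / (real n)\<^sup>2"
proof -
  obtain d D where dD: "0 < d" "0 < D"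
    "\<And>n. 1 \<le> n \<Longrightarrow> d / real n \<le> sqrt (2 * (\<Sum>i. (kap n i)\<^sup>2))"
    "\<And>n. 1 \<le> n \<Longrightarrow> sqrt (2 * (\<Sum>i. (kap n i)\<^sup>2)) \<le> D / real n"
    using weight_scale by metis
  show thesis
  proof
    show "0 < \<sigma>\<^sup>2 * d" "0 < \<sigma>\<^sup>2 * D" using dD sigma by auto
    fix n :: nat assume n: "1 \<le> n"
    have "0 \<le> \<sigma>\<^sup>2 / real n" by simp
    from mult_left_mono[OF dD(3)[OF n] this] mult_left_mono[OF dD(4)[OF n] this]
    show "\<sigma>\<^sup>2 * d / (real n)\<^sup>2 \<le> null_scale kap \<sigma> n" "null_scale kap \<sigma> n \<le> \<sigma>\<^sup>2 * D / (real n)\<^sup>2"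
      by (simp_all add: null_scale_def power2_eq_square)
  qed
qed

lemma null_scale_pos:
  assumes n: "1 \<le> n" shows "0 < null_scale kap \<sigma> n"
proof -
  obtain d where "0 < d" "d / (real n)\<^sup>2 \<le> null_scale kap \<sigma> n"
    using null_scale_bounds n by metis
  moreover have "0 < d / (real n)\<^sup>2" using \<open>0 < d\<close> n by simp
  ultimately show ?thesis by linarith
qed

section \<open>Consistency and inconsistency in terms of the signal\<close>

lemma std_cdf_limit:
  assumes ns: "filterlim ns at_top sequentially" and fs: "\<And>k. fs k \<in> l2"
    and m: "\<forall>\<^sub>F k in sequentially. signal kap \<sigma> (ns k) (fs k) \<le> m"
  shows "(\<lambda>k. std_cdf kap \<sigma> (ns k) (fs k) x) \<longlonglongrightarrow> Phi x"
proof (rule std_cdf_tendsto_Phi[OF sigma nonneg summ A1 _ fs m])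
  obtain d D where dD: "0 < d" "0 < D"
    "\<And>n. 1 \<le> n \<Longrightarrow> kap n 0 \<le> D * real n powr (2 * r - 2)"
    "\<And>n. 1 \<le> n \<Longrightarrow> d / real n \<le> sqrt (2 * (\<Sum>i. (kap n i)\<^sup>2))"
    using weight_scale by metis
  have ev: "\<forall>\<^sub>F k in sequentially. 1 \<le> ns k" using ns by (simp add: filterlim_at_top)
  then show "\<forall>\<^sub>F k in sequentially. 1 \<le> ns k \<and> 0 < (\<Sum>i. (kap (ns k) i)\<^sup>2)"
  proof eventually_elim
    case (elim k)
    have "0 < d / real (ns k)" using dD elim by simp
    with dD(4)[OF elim] have "0 < sqrt (2 * (\<Sum>i. (kap (ns k) i)\<^sup>2))" by linarith
    with elim show ?case by simp
  qed
  \<comment> \<open>The largest normalized weight is at most of order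
    \<open>n powr (2 * r - 2)\<close> over \<open>1 / n\<close>, which vanishes because
    \<open>r < 1 / 2\<close>.\<close>
  have "((\<lambda>n. D / d * real n powr (2 * r - 1)) \<longlongrightarrow> D / d * 0) at_top"
    using r by (intro tendsto_mult tendsto_const tendsto_neg_powr filterlim_real_sequentially) simp
  from filterlim_compose[OF this ns]
  have lim: "(\<lambda>k. D / d * real (ns k) powr (2 * r - 1)) \<longlonglongrightarrow> 0" by simp
  have "\<forall>\<^sub>F k in sequentially. norm (kap (ns k) 0 / sqrt (2 * (\<Sum>i. (kap (ns k) i)\<^sup>2)))
      \<le> D / d * real (ns k) powr (2 * r - 1)"
    using ev
  proof eventually_elim
    case (elim k)
    define N where "N = real (ns k)"
    have N: "0 < N" using elim by (simp add: N_def)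
    have "kap (ns k) 0 / sqrt (2 * (\<Sum>i. (kap (ns k) i)\<^sup>2)) \<le> (D * N powr (2 * r - 2)) / (d / N)"
      using dD(3,4)[OF elim] dD(1,2) N nonneg by (intro frac_le) (auto simp: N_def)
    also have "\<dots> = D / d * (N powr (2 * r - 2) * N powr 1)" using N by simp
    also have "N powr (2 * r - 2) * N powr 1 = N powr (2 * r - 1)" by (subst powr_add[symmetric]) simp
    finally have le: "kap (ns k) 0 / sqrt (2 * (\<Sum>i. (kap (ns k) i)\<^sup>2)) \<le> D / d * N powr (2 * r - 1)" .
    have "0 \<le> (\<Sum>i. (kap (ns k) i)\<^sup>2)"
      by (intro suminf_nonneg decreasing_summable_square(1)[OF nonneg A1 summ]) auto
    with le show ?case using nonneg[of "ns k" 0] by (simp add: N_def)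
  qed
  from Lim_null_comparison[OF this lim]
  show "(\<lambda>k. kap (ns k) 0 / sqrt (2 * (\<Sum>i. (kap (ns k) i)\<^sup>2))) \<longlonglongrightarrow> 0" .
qed

lemma std_cdf_null_limit:
  assumes "filterlim ns at_top sequentially"
  shows "(\<lambda>k. std_cdf kap \<sigma> (ns k) (\<lambda>_. 0) x) \<longlonglongrightarrow> Phi x"
  by (rule std_cdf_limit[OF assms, where m=0]) (auto simp: l2_def signal_def)

lemma consistent_if_signal_bounded_below:
  assumes ns: "filterlim ns at_top sequentially" and fs: "\<And>k. fs k \<in> l2"
    and m: "\<forall>\<^sub>F k in sequentially. signal kap \<sigma> (ns k) (fs k) \<le> m"
    and c: "0 < c" "\<forall>\<^sub>F k in sequentially. c \<le> signal kap \<sigma> (ns k) (fs k)"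
  shows "consistent kap \<sigma> ns fs"
  unfolding consistent_def
proof (intro allI impI)
  fix \<alpha> :: real and t :: "nat \<Rightarrow> real"
  assume \<alpha>: "0 < \<alpha> \<and> \<alpha> < 1" and lim: "(\<lambda>i. alpha_err kap \<sigma> (ns i) (t i) / \<alpha>) \<longlonglongrightarrow> 1"
  have ev: "\<forall>\<^sub>F k in sequentially. 1 \<le> ns k" using ns by (simp add: filterlim_at_top)
  let ?t = "\<lambda>k. t k / null_scale kap \<sigma> (ns k)"
  have "(\<lambda>k. 1 - \<alpha> * (alpha_err kap \<sigma> (ns k) (t k) / \<alpha>)) \<longlonglongrightarrow> 1 - \<alpha> * 1"
    by (intro tendsto_intros lim)
  then have "(\<lambda>k. 1 - alpha_err kap \<sigma> (ns k) (t k)) \<longlonglongrightarrow> 1 - \<alpha>" using \<alpha> by simp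
  moreover have "\<forall>\<^sub>F k in sequentially. 1 - alpha_err kap \<sigma> (ns k) (t k) = std_cdf kap \<sigma> (ns k) (\<lambda>_. 0) (?t k)"
    using ev by eventually_elim (simp add: alpha_err_eq_std_cdf null_scale_pos)
  ultimately have t: "(\<lambda>k. std_cdf kap \<sigma> (ns k) (\<lambda>_. 0) (?t k)) \<longlonglongrightarrow> 1 - \<alpha>"
    by (rule Lim_transform_eventually)
  have "limsup (\<lambda>k. ereal (beta_err kap \<sigma> (ns k) (t k) (fs k)))
      = limsup (\<lambda>k. ereal (std_cdf kap \<sigma> (ns k) (fs k) (?t k - signal kap \<sigma> (ns k) (fs k))))"
    by (rule Limsup_eq, use ev in eventually_elim) (simp add: beta_err_eq_std_cdf null_scale_pos)
  also have "\<dots> < ereal (1 - \<alpha>)"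
    by (rule asymptotic_type_II_error[OF std_cdf_limit[OF ns fs m] std_cdf_null_limit[OF ns]
          std_cdf_mono std_cdf_mono c(2) c(1) _ _ t]) (use \<alpha> in auto)
  finally show "limsup (\<lambda>k. ereal (beta_err kap \<sigma> (ns k) (t k) (fs k))) < ereal (1 - \<alpha>)" .
qed

text \<open>The thresholds are unrestricted here, so the distribution functions must converge
  uniformly, which Polya's theorem provides.\<close>

lemma inconsistent_if_signal_vanishes:
  assumes ns: "filterlim ns at_top sequentially" and fs: "\<And>k. fs k \<in> l2"
    and m: "(\<lambda>k. signal kap \<sigma> (ns k) (fs k)) \<longlonglongrightarrow> 0"
  shows "inconsistent kap \<sigma> ns fs"
  unfolding inconsistent_def
proof (intro allI)
  fix t :: "nat \<Rightarrow> real"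
  let ?t = "\<lambda>k. t k / null_scale kap \<sigma> (ns k)"
  have ev: "\<forall>\<^sub>F k in sequentially. 1 \<le> ns k" using ns by (simp add: filterlim_at_top)
  have "\<forall>\<^sub>F k in sequentially. signal kap \<sigma> (ns k) (fs k) < 1" using m by (rule order_tendstoD) simp
  then have m1: "\<forall>\<^sub>F k in sequentially. signal kap \<sigma> (ns k) (fs k) \<le> 1" by eventually_elim simp
  have "(\<lambda>k. (1 - std_cdf kap \<sigma> (ns k) (\<lambda>_. 0) (?t k)) + std_cdf kap \<sigma> (ns k) (fs k) (?t k - signal kap \<sigma> (ns k) (fs k))) \<longlonglongrightarrow> 1"
    by (intro asymptotic_error_sum polya_uniform std_cdf_limit[OF ns fs m1] std_cdf_null_limit[OF ns]
        std_cdf_mono std_cdf_range m)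
  moreover have "\<forall>\<^sub>F k in sequentially. (1 - std_cdf kap \<sigma> (ns k) (\<lambda>_. 0) (?t k)) + std_cdf kap \<sigma> (ns k) (fs k) (?t k - signal kap \<sigma> (ns k) (fs k))
     = alpha_err kap \<sigma> (ns k) (t k) + beta_err kap \<sigma> (ns k) (t k) (fs k)"
    using ev by eventually_elim (simp add: alpha_err_eq_std_cdf beta_err_eq_std_cdf null_scale_pos)
  ultimately have "(\<lambda>k. alpha_err kap \<sigma> (ns k) (t k) + beta_err kap \<sigma> (ns k) (t k) (fs k)) \<longlonglongrightarrow> 1"
    by (rule Lim_transform_eventually)
  then have "(\<lambda>k. ereal (alpha_err kap \<sigma> (ns k) (t k) + beta_err kap \<sigma> (ns k) (t k) (fs k))) \<longlonglongrightarrow> ereal 1"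
    by simp
  from lim_imp_Liminf[OF _ this] have "liminf (\<lambda>k. ereal (alpha_err kap \<sigma> (ns k) (t k) + beta_err kap \<sigma> (ns k) (t k) (fs k))) = 1"
    by simp
  then show "1 \<le> liminf (\<lambda>k. ereal (alpha_err kap \<sigma> (ns k) (t k) + beta_err kap \<sigma> (ns k) (t k) (fs k)))"
    by simp
qed

section \<open>Bounds for signals on the shell\<close>

lemma weighted_square_sum_le:
  assumes "th \<in> l2" "\<And>i. th i \<noteq> 0 \<Longrightarrow> kap n i \<le> M"
  shows "(\<Sum>i. kap n i * (th i)\<^sup>2) \<le> M * (l2norm th)\<^sup>2"
proof -
  have s: "summable (\<lambda>i. (th i)\<^sup>2)" using assms by (simp add: l2_def)
  have "(\<Sum>i. kap n i * (th i)\<^sup>2) \<le> (\<Sum>i. M * (th i)\<^sup>2)"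
  proof (intro suminf_le summable_mult s)
    show "kap n i * (th i)\<^sup>2 \<le> M * (th i)\<^sup>2" for i
      using assms(2)[of i] by (cases "th i = 0") (auto intro: mult_right_mono)
  qed (rule decreasing_summable_square(2)[OF nonneg A1 assms(1)])
  then show ?thesis by (simp add: suminf_mult[OF s] l2norm_sq[OF assms(1)])
qed

text \<open>\<open>M\<close> bounds the weights only where \<open>th\<close> is nonzero, so one
  estimate serves arbitrary functions, through the first weight, and tails, through the weight at
  the cut.\<close>

lemma signal_le:
  obtains D where "0 < D"
    "\<And>n th M. 1 \<le> n \<Longrightarrow> th \<in> l2 \<Longrightarrow> (\<And>i. th i \<noteq> 0 \<Longrightarrow> kap n i \<le> M) \<Longrightarrow> 0 \<le> M
      \<Longrightarrow> signal kap \<sigma> n th \<le> D * (M * (l2norm th)\<^sup>2 * (real n)\<^sup>2)"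
proof -
  obtain d where d: "0 < d" "\<And>n. 1 \<le> n \<Longrightarrow> d / (real n)\<^sup>2 \<le> null_scale kap \<sigma> n"
    using null_scale_bounds by metis
  show thesis
  proof (rule that[of "1 / d"])
    show "0 < 1 / d" using d by simp
    fix n :: nat and th M assume n: "1 \<le> n" and th: "th \<in> l2" "\<And>i. th i \<noteq> 0 \<Longrightarrow> kap n i \<le> M" and M: "0 \<le> M"
    have "signal kap \<sigma> n th \<le> M * (l2norm th)\<^sup>2 / (d / (real n)\<^sup>2)"
      unfolding signal_def using weighted_square_sum_le[OF th] d n M by (intro frac_le) auto
    then show "signal kap \<sigma> n th \<le> 1 / d * (M * (l2norm th)\<^sup>2 * (real n)\<^sup>2)" by simp
  qed
qed

lemma shell_signal_upper:
  assumes C: "0 < C"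
  obtains m where "\<And>n th. 1 \<le> n \<Longrightarrow> th \<in> l2 \<Longrightarrow> l2norm th < C * real n powr (- r) \<Longrightarrow> signal kap \<sigma> n th \<le> m"
proof -
  obtain D where D: "0 < D" "\<And>n. 1 \<le> n \<Longrightarrow> kap n 0 \<le> D * real n powr (2 * r - 2)"
    using weight_scale by metis
  obtain E where E: "0 < E"
    "\<And>n th M. 1 \<le> n \<Longrightarrow> th \<in> l2 \<Longrightarrow> (\<And>i. th i \<noteq> 0 \<Longrightarrow> kap n i \<le> M) \<Longrightarrow> 0 \<le> M
      \<Longrightarrow> signal kap \<sigma> n th \<le> E * (M * (l2norm th)\<^sup>2 * (real n)\<^sup>2)"
    by (rule signal_le) blast
  show thesis
  proof (rule that)
    fix n :: nat and th assume n: "1 \<le> n" and th: "th \<in> l2" "l2norm th < C * real n powr (- r)"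
    define N where "N = real n"
    have N: "0 < N" using n by (simp add: N_def)
    have "signal kap \<sigma> n th \<le> E * (D * N powr (2 * r - 2) * (l2norm th)\<^sup>2 * N\<^sup>2)"
      unfolding N_def using D n A1[of 0] by (intro E n th) (auto intro: order_trans)
    also have "\<dots> \<le> E * (D * N powr (2 * r - 2) * (C * N powr (- r))\<^sup>2 * N\<^sup>2)"
      using E D th N by (intro mult_left_mono mult_right_mono power_mono) (auto simp: l2norm_nonneg N_def)
    also have "\<dots> = E * D * C\<^sup>2 * (N powr (2 * r - 2) * N powr (- r) * N powr (- r) * N powr 2)"
      using N by (simp add: power2_eq_square power_mult_distrib powr_numeral)
    also have "N powr (2 * r - 2) * N powr (- r) * N powr (- r) * N powr 2 = 1"
      by (rule shell_powr_product[OF N])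
    finally show "signal kap \<sigma> n th \<le> E * D * C\<^sup>2" by simp
  qed
qed

text \<open>Beyond \<open>\<Lambda> * kn\<close> a ball element keeps at most half of the smallest
  squared norm allowed on the shell. The rest sits where A5 holds the weights above a multiple of
  \<open>kapn\<close>.\<close>

lemma shell_signal_lower:
  assumes c: "0 < c" and P0: "0 < P0"
  obtains m where "0 < m"
    "\<And>n th. 1 \<le> n \<Longrightarrow> th \<in> besov_ball s P0 \<Longrightarrow> c * real n powr (- r) < l2norm th \<Longrightarrow> m \<le> signal kap \<sigma> n th"
proof -
  obtain d where d: "0 < d" "\<And>n. 1 \<le> n \<Longrightarrow> d * real n powr (2 * r - 2) \<le> kapn kap n"
    "\<And>n. 1 \<le> n \<Longrightarrow> d * real n powr (2 - 4 * r) \<le> real (kn kap n)"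
    using weight_scale by metis
  obtain E where E: "0 < E" "\<And>n. 1 \<le> n \<Longrightarrow> null_scale kap \<sigma> n \<le> E / (real n)\<^sup>2"
    using null_scale_bounds by metis
  \<comment> \<open>The second entry makes \<open>(\<Lambda> * d) powr (2 * s)\<close> at least
    \<open>2 * P0 / c\<^sup>2\<close>, as the tail bound requires; the entry 2 secures
    \<open>1 < \<Lambda>\<close> for \<open>A5b\<close>.\<close>
  define \<Lambda> where "\<Lambda> = max 2 ((2 * P0 / c\<^sup>2) powr (1 / (2 * s)) / d)"
  have \<Lambda>: "1 < \<Lambda>" by (simp add: \<Lambda>_def)
  have "(2 * P0 / c\<^sup>2) powr (1 / (2 * s)) / d \<le> \<Lambda>" unfolding \<Lambda>_def by (rule max.cobounded2)
  then have "(2 * P0 / c\<^sup>2) powr (1 / (2 * s)) \<le> \<Lambda> * d" using d by (simp add: field_simps)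
  then have "((2 * P0 / c\<^sup>2) powr (1 / (2 * s))) powr (2 * s) \<le> (\<Lambda> * d) powr (2 * s)"
    using s_pos by (intro powr_mono2) auto
  then have \<Lambda>d: "2 * P0 / c\<^sup>2 \<le> (\<Lambda> * d) powr (2 * s)"
    using s_pos P0 c by (simp add: powr_powr)
  obtain C5 where C5: "0 < C5" "\<And>n. 1 \<le> n \<Longrightarrow> C5 * kapn kap n \<le> kapat kap n \<Lambda>"
    using A5b[OF \<Lambda>] by blast
  show thesis
  proof (rule that)
    show "0 < C5 * d * (c\<^sup>2 / 2) / E" using C5 d c E by simp
    fix n :: nat and th assume n: "1 \<le> n" and th: "th \<in> besov_ball s P0" and nrm: "c * real n powr (- r) < l2norm th"
    define N where "N = real n"
    have N: "0 < N" using n by (simp add: N_def)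
    have l2: "th \<in> l2" using th by (simp add: besov_ball_alt)
    have sth: "summable (\<lambda>i. (th i)\<^sup>2)" using l2 by (simp add: l2_def)
    define lam where "lam = \<Lambda> * real (kn kap n)"
    define \<tau> where "\<tau> = (\<Sum>i. (tail th lam i)\<^sup>2)"
    have "\<Lambda> * (d * N powr (2 - 4 * r)) \<le> lam"
      unfolding lam_def N_def using d(3)[OF n] \<Lambda> by (intro mult_left_mono) auto
    moreover have lo: "0 < \<Lambda> * (d * N powr (2 - 4 * r))" using \<Lambda> d N by simp
    ultimately have lam0: "0 < lam" and "(\<Lambda> * (d * N powr (2 - 4 * r))) powr (2 * s) \<le> lam powr (2 * s)"
      using s_pos by (auto intro: powr_mono2)
    moreover have "(\<Lambda> * (d * N powr (2 - 4 * r))) powr (2 * s) = (\<Lambda> * d) powr (2 * s) * N powr (2 * r)"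
    proof -
      have "\<Lambda> * (d * N powr (2 - 4 * r)) = (\<Lambda> * d) * N powr (2 - 4 * r)" by simp
      then show ?thesis using \<Lambda> d by (simp only: powr_mult powr_powr s_exponents)
    qed
    moreover have "2 * P0 / c\<^sup>2 * N powr (2 * r) \<le> (\<Lambda> * d) powr (2 * s) * N powr (2 * r)"
      using \<Lambda>d by (intro mult_right_mono) auto
    ultimately have lamge: "2 * P0 / c\<^sup>2 * N powr (2 * r) \<le> lam powr (2 * s)" by linarith
    have \<tau>0: "0 \<le> \<tau>" unfolding \<tau>_def by (rule suminf_tail_nonneg[OF l2])
    have "2 * P0 / c\<^sup>2 * N powr (2 * r) * \<tau> \<le> lam powr (2 * s) * \<tau>"
      using lamge \<tau>0 by (rule mult_right_mono)
    also have "\<dots> \<le> P0" using th lam0 by (simp add: besov_ball_alt \<tau>_def)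
    finally have \<tau>: "\<tau> \<le> c\<^sup>2 / 2 * N powr (- 2 * r)"
      using P0 c N by (simp add: powr_minus field_simps)
    have "(c * N powr (- r))\<^sup>2 \<le> (l2norm th)\<^sup>2"
      using nrm c by (intro power_mono) (auto simp: N_def)
    moreover have "(c * N powr (- r))\<^sup>2 = c\<^sup>2 * N powr (- 2 * r)"
      by (simp add: power_mult_distrib power2_eq_square flip: powr_add)
    ultimately have "c\<^sup>2 * N powr (- 2 * r) \<le> (\<Sum>i. (th i)\<^sup>2)" by (simp add: l2norm_sq[OF l2])
    then have head: "c\<^sup>2 / 2 * N powr (- 2 * r) \<le> (\<Sum>i. (th i)\<^sup>2 - (tail th lam i)\<^sup>2)"
      using \<tau> by (simp add: suminf_diff[OF sth tail_summable[OF l2], symmetric] \<tau>_def)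
    have kap_ge: "C5 * kapn kap n * ((th i)\<^sup>2 - (tail th lam i)\<^sup>2) \<le> kap n i * (th i)\<^sup>2" for i
    proof (cases "lam < real (Suc i)")
      case True
      then show ?thesis by (simp add: tail_def nonneg)
    next
      case False
      \<comment> \<open>The integer \<open>Suc i\<close> is at most the floor of \<open>lam\<close>;
        \<open>kw\<close> shifts that floor down by one, to a position not before
        \<open>i\<close>.\<close>
      then have "Suc i \<le> nat \<lfloor>lam\<rfloor>" by (simp add: le_nat_iff le_floor_iff)
      then have "kapat kap n \<Lambda> \<le> kap n i"
        unfolding kapat_def kw_def lam_def[symmetric] by (intro A1) simp
      then have "C5 * kapn kap n \<le> kap n i" using C5(2)[OF n] by linarith
      then show ?thesis using False by (auto simp: tail_def intro: mult_right_mono)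
    qed
    have sh: "summable (\<lambda>i. (th i)\<^sup>2 - (tail th lam i)\<^sup>2)" by (intro summable_diff sth tail_summable l2)
    have "C5 * d * (c\<^sup>2 / 2) / N\<^sup>2 = C5 * (d * N powr (2 * r - 2)) * (c\<^sup>2 / 2 * N powr (- 2 * r))"
    proof -
      have "N powr (2 * r - 2) * N powr (- 2 * r) = N powr (- 2)" by (subst powr_add[symmetric]) simp
      also have "\<dots> = 1 / N\<^sup>2" using N by (simp add: powr_minus powr_numeral divide_inverse)
      finally have "N powr (2 * r - 2) * N powr (- 2 * r) = 1 / N\<^sup>2" .
      then show ?thesis by (simp add: ac_simps)
    qed
    also have "\<dots> \<le> C5 * kapn kap n * (\<Sum>i. (th i)\<^sup>2 - (tail th lam i)\<^sup>2)"
      using d(1) C5(1) by (intro mult_mono mult_left_mono head order_refl d(2)[OF n, folded N_def])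
        (auto intro!: mult_nonneg_nonneg order_trans[OF _ d(2)[OF n]])
    also have "\<dots> = (\<Sum>i. C5 * kapn kap n * ((th i)\<^sup>2 - (tail th lam i)\<^sup>2))"
      by (rule suminf_mult[symmetric, OF sh])
    also have "\<dots> \<le> (\<Sum>i. kap n i * (th i)\<^sup>2)"
      by (intro suminf_le kap_ge summable_mult sh decreasing_summable_square(2)[OF nonneg A1 l2])
    finally have num: "C5 * d * (c\<^sup>2 / 2) / N\<^sup>2 \<le> (\<Sum>i. kap n i * (th i)\<^sup>2)" .
    have "C5 * d * (c\<^sup>2 / 2) / E = C5 * d * (c\<^sup>2 / 2) / N\<^sup>2 / (E / N\<^sup>2)" using N by simp
    also have "\<dots> \<le> signal kap \<sigma> n th" unfolding signal_def
    proof (rule frac_le)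
      show "0 \<le> (\<Sum>i. kap n i * (th i)\<^sup>2)"
        by (intro suminf_nonneg decreasing_summable_square(2)[OF nonneg A1 l2]) (auto simp: nonneg)
    qed (use num null_scale_pos[OF n] E(2)[OF n] in \<open>auto simp: N_def\<close>)
    finally show "C5 * d * (c\<^sup>2 / 2) / E \<le> signal kap \<sigma> n th" .
  qed
qed

lemma besov_shell_consistent:
  assumes "0 < c" "c < C" "0 < P0" and ns: "filterlim ns at_top sequentially"
    and fs: "\<And>i. fs i \<in> besov_ball s P0" and shell: "in_shell r c C ns fs"
  shows "consistent kap \<sigma> ns fs"
proof -
  have ev: "\<forall>\<^sub>F k in sequentially. 1 \<le> ns k" using ns by (simp add: filterlim_at_top)
  have l2: "fs k \<in> l2" for k using fs by (simp add: besov_ball_alt)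
  obtain M where M: "\<And>n th. 1 \<le> n \<Longrightarrow> th \<in> l2 \<Longrightarrow> l2norm th < C * real n powr (- r) \<Longrightarrow> signal kap \<sigma> n th \<le> M"
    using shell_signal_upper[of C] assms by (metis order.strict_trans)
  obtain m where m: "0 < m"
    "\<And>n th. 1 \<le> n \<Longrightarrow> th \<in> besov_ball s P0 \<Longrightarrow> c * real n powr (- r) < l2norm th \<Longrightarrow> m \<le> signal kap \<sigma> n th"
    using shell_signal_lower[OF assms(1,3)] by metis
  show ?thesis
  proof (rule consistent_if_signal_bounded_below[OF ns l2 _ m(1)])
    show "\<forall>\<^sub>F k in sequentially. signal kap \<sigma> (ns k) (fs k) \<le> M"
      using ev by eventually_elim (use shell l2 in \<open>auto simp: in_shell_def intro!: M\<close>)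
    show "\<forall>\<^sub>F k in sequentially. m \<le> signal kap \<sigma> (ns k) (fs k)"
      using ev by eventually_elim (use shell fs in \<open>auto simp: in_shell_def intro!: m\<close>)
  qed
qed


text \<open>The witnesses are tails of \<open>f\<close>, each with a sample size matched to its
  norm. Their cuts outgrow \<open>kn\<close>, so A4 makes the weights on them negligible against
  \<open>kapn\<close>.\<close>

lemma besov_tail_inconsistent:
  assumes P0: "0 < P0" and f: "f \<in> l2" "f \<notin> span_space (besov_ball s P0)"
    and V: "l2convex V" "ortho_symmetric V" "f \<in> V"
  shows "\<exists>c C ns fs. 0 < c \<and> c < C \<and> filterlim ns at_top sequentially \<and>
              (\<forall>i. fs i \<in> V) \<and> in_shell r c C ns fs \<and> inconsistent kap \<sigma> ns fs"
proof -
  obtain D where D: "0 < D" "\<And>n. 1 \<le> n \<Longrightarrow> kapn kap n \<le> D * real n powr (2 * r - 2)"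
    "\<And>n. 1 \<le> n \<Longrightarrow> real (kn kap n) \<le> D * real n powr (2 - 4 * r)"
    "\<And>n. 1 \<le> n \<Longrightarrow> 1 \<le> kn kap n"
    using weight_scale by metis
  obtain E where E: "0 < E"
    "\<And>n th M. 1 \<le> n \<Longrightarrow> th \<in> l2 \<Longrightarrow> (\<And>i. th i \<noteq> 0 \<Longrightarrow> kap n i \<le> M) \<Longrightarrow> 0 \<le> M
      \<Longrightarrow> signal kap \<sigma> n th \<le> E * (M * (l2norm th)\<^sup>2 * (real n)\<^sup>2)"
    by (rule signal_le) blast
  obtain C4 la where C4: "0 < C4" "1 < la"
    "\<And>\<delta> n. 0 < \<delta> \<Longrightarrow> 1 \<le> n \<Longrightarrow> kapat kap n (1 + \<delta>) < C4 * (1 + \<delta>) powr (- la) * kapn kap n"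
    using A4 by blast
  have "\<exists>lam. real (Suc k) < lam \<and> real (Suc k) < lam powr (2 * s) * (\<Sum>i. (tail f lam i)\<^sup>2)
      \<and> (\<Sum>i. (tail f lam i)\<^sup>2) < 1 / real (Suc k)" for k
    using large_tail_outside_span[OF f s_pos P0, of "real (Suc k)" "1 / real (Suc k)"]
    by (metis of_nat_0_less_iff zero_less_Suc zero_less_divide_1_iff)
  then obtain lam where lam: "\<And>k. real (Suc k) < lam k"
    "\<And>k. real (Suc k) < lam k powr (2 * s) * (\<Sum>i. (tail f (lam k) i)\<^sup>2)"
    "\<And>k. (\<Sum>i. (tail f (lam k) i)\<^sup>2) < 1 / real (Suc k)" by metis
  define fs where "fs k = tail f (lam k)" for k
  define e where "e k = l2norm (fs k)" for k
  \<comment> \<open>This solves \<open>e k = n powr (- r)\<close> for \<open>n\<close> and rounds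
    up.\<close>
  define ns where "ns k = nat \<lceil>e k powr (- 1 / r)\<rceil>" for k
  have l2: "fs k \<in> l2" for k using tail_summable[OF f(1)] by (simp add: fs_def l2_def)
  have e2: "(e k)\<^sup>2 = (\<Sum>i. (tail f (lam k) i)\<^sup>2)" for k
    using l2norm_sq[OF l2[of k]] by (simp add: e_def fs_def)
  have lam0: "0 < lam k" for k using lam(1)[of k] by linarith
  have e0: "0 < e k" for k
  proof -
    have "(e k)\<^sup>2 \<noteq> 0" using lam(2)[of k] unfolding e2 by auto
    then show ?thesis using l2norm_nonneg[OF l2[of k]] by (simp add: e_def less_le)
  qed
  have e2_lt: "(e k)\<^sup>2 < 1 / real (Suc k)" for k using lam(3) by (simp only: e2)
  have e1: "e k < 1" for k
  proof (rule power2_less_imp_less)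
    show "(e k)\<^sup>2 < 1\<^sup>2" using e2_lt[of k] by (rule less_le_trans) simp
  qed simp
  define u where "u k = e k powr (- 1 / r)" for k
  \<comment> \<open>The squared norm is below \<open>1 / real (Suc k)\<close> and
    \<open>1 / r\<close> exceeds 2; this drives the sample sizes to infinity.\<close>
  have u: "real (Suc k) < u k" for k
  proof -
    have "real (Suc k) < 1 / (e k)\<^sup>2" using e2_lt[of k] e0[of k] by (simp add: field_simps)
    also have "\<dots> = e k powr (- 2)" using e0[of k] by (simp add: powr_minus powr_numeral divide_inverse)
    also have "\<dots> \<le> u k" unfolding u_def using e0[of k] e1[of k] r
      by (intro powr_mono') (auto simp: field_simps)
    finally show ?thesis .
  qed
  \<comment> \<open>Rounding up at most doubles a number that is at least 1.\<close>
  have ns: "u k \<le> real (ns k)" "real (ns k) \<le> 2 * u k" for k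
  proof -
    have "1 \<le> u k" using u[of k] by simp
    then show "u k \<le> real (ns k)" "real (ns k) \<le> 2 * u k"
      unfolding ns_def u_def[symmetric] by linarith+
  qed
  have ns1: "1 \<le> ns k" for k using u[of k] ns(1)[of k] by linarith
  have ns_top: "filterlim ns at_top sequentially"
  proof -
    have "real k \<le> real (ns k)" for k using u[of k] ns(1)[of k] by linarith
    then have "k \<le> ns k" for k by simp
    then show ?thesis by (intro filterlim_at_top_mono[OF filterlim_ident]) auto
  qed
  have ur: "u k powr (- r) = e k" for k
    unfolding u_def powr_powr using r e0[of k] by simp
  have shell_lo: "real (ns k) powr (- r) \<le> e k" for k
    using ns(1)[of k] u[of k] r ur[of k] powr_mono2'[of "- r" "u k" "real (ns k)"] by simp
  have shell_hi: "e k \<le> 2 powr r * real (ns k) powr (- r)" for k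
  proof -
    have "(2 * u k) powr (- r) \<le> real (ns k) powr (- r)"
      using ns(2)[of k] ns1[of k] r by (intro powr_mono2') auto
    then have "2 powr (- r) * e k \<le> real (ns k) powr (- r)"
      using ur[of k] by (simp add: powr_mult)
    then have "2 powr r * (2 powr (- r) * e k) \<le> 2 powr r * real (ns k) powr (- r)"
      by (rule mult_left_mono) simp
    also have "2 powr r * (2 powr (- r) * e k) = e k"
      by (simp only: powr_add[symmetric] mult.assoc[symmetric]) simp
    finally show ?thesis .
  qed
  \<comment> \<open>The factor \<open>1 / 2\<close> and the added 1 turn the weak bounds into the
    strict ones of \<open>in_shell\<close>.\<close>
  have shell: "in_shell r (1 / 2) (2 powr r + 1) ns fs"
    unfolding in_shell_def
  proof
    fix k
    have "0 < real (ns k) powr (- r)" using ns1[of k] by simp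
    then show "1 / 2 * real (ns k) powr (- r) < l2norm (fs k) \<and>
        l2norm (fs k) < (2 powr r + 1) * real (ns k) powr (- r)"
      using shell_lo[of k] shell_hi[of k] unfolding e_def distrib_right by linarith
  qed
  \<comment> \<open>The large tail gives \<open>lam k\<close> at least
    \<open>real (Suc k) powr (1 / (2 * s)) * e k powr (- (1 / s))\<close>, and \<open>kn\<close> is
    at most \<open>D * 2 powr (2 - 4 * r) * e k powr (- (1 / s))\<close>. In the quotient the powers
    of \<open>e k\<close> cancel and \<open>y k\<close> remains.\<close>
  define y where "y k = real (Suc k) powr (1 / (2 * s)) / (D * 2 powr (2 - 4 * r))" for k
  have y0: "0 < y k" for k using D by (simp add: y_def)
  have y_top: "filterlim y at_top sequentially"
  proof -
    have "filterlim (\<lambda>k. real (Suc k)) at_top sequentially"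
      by (rule filterlim_compose[OF filterlim_real_sequentially filterlim_Suc])
    then have "(\<lambda>k. real (Suc k) powr (- (1 / (2 * s)))) \<longlonglongrightarrow> 0"
      using s_pos by (intro tendsto_neg_powr) auto
    then have "filterlim (\<lambda>k. inverse (real (Suc k) powr (- (1 / (2 * s))))) at_top sequentially"
      by (rule filterlim_inverse_at_top) simp
    then have "filterlim (\<lambda>k. real (Suc k) powr (1 / (2 * s))) at_top sequentially"
      by (simp add: powr_minus)
    then show ?thesis unfolding y_def divide_inverse
      using D by (intro filterlim_at_top_mult_tendsto_pos[OF tendsto_const]) auto
  qed
  have ratio: "y k \<le> lam k / real (kn kap (ns k))" for k
  proof -
    have "real (Suc k) powr (1 / (2 * s)) \<le> (lam k powr (2 * s) * (e k)\<^sup>2) powr (1 / (2 * s))"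
      using lam(2)[of k] s_pos by (intro powr_mono2) (auto simp: e2)
    also have "\<dots> = lam k * e k powr (1 / s)"
    proof -
      have "(e k)\<^sup>2 powr (1 / (2 * s)) = (e k powr 2) powr (1 / (2 * s))"
        using e0[of k] by (simp add: powr_numeral)
      also have "\<dots> = e k powr (1 / s)" unfolding powr_powr by simp
      finally show ?thesis using s_pos lam0[of k] by (simp add: powr_mult powr_powr)
    qed
    finally have 1: "real (Suc k) powr (1 / (2 * s)) \<le> lam k * e k powr (1 / s)" .
    have "real (ns k) powr (2 - 4 * r) \<le> (2 * u k) powr (2 - 4 * r)"
      using ns(2)[of k] r by (intro powr_mono2) auto
    also have "\<dots> = 2 powr (2 - 4 * r) * e k powr (- (1 / s))"
      using s_exponents(2) e0[of k] by (simp add: powr_mult u_def powr_powr)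
    finally have "D * real (ns k) powr (2 - 4 * r) \<le> D * (2 powr (2 - 4 * r) * e k powr (- (1 / s)))"
      using D(1) by simp
    with D(3)[OF ns1[of k]]
    have 2: "real (kn kap (ns k)) \<le> D * 2 powr (2 - 4 * r) * e k powr (- (1 / s))" by simp
    have q: "0 < real (kn kap (ns k))" using D(4)[OF ns1[of k]] by simp
    have "y k * real (kn kap (ns k)) \<le> y k * (D * 2 powr (2 - 4 * r) * e k powr (- (1 / s)))"
      using 2 y0[of k] by simp
    also have "\<dots> = real (Suc k) powr (1 / (2 * s)) * e k powr (- (1 / s))"
      using D(1) by (simp add: y_def)
    also have "\<dots> \<le> lam k * e k powr (1 / s) * e k powr (- (1 / s))"
      using 1 by (rule mult_right_mono) simp
    also have "\<dots> = lam k" using e0[of k] by (simp add: powr_minus)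
    finally show ?thesis using q by (simp add: pos_le_divide_eq)
  qed
  have sig0: "0 \<le> signal kap \<sigma> (ns k) (fs k)" for k
  proof -
    have "summable (\<lambda>i. kap (ns k) i * (fs k i)\<^sup>2)"
      by (rule decreasing_summable_square(2)[OF nonneg A1 l2])
    then have "0 \<le> (\<Sum>i. kap (ns k) i * (fs k i)\<^sup>2)" by (rule suminf_nonneg) (simp add: nonneg)
    then show ?thesis unfolding signal_def using null_scale_pos[OF ns1[of k]] by simp
  qed
  have "\<forall>\<^sub>F k in sequentially. 1 < y k" using y_top by (simp add: filterlim_at_top_dense)
  then have "\<forall>\<^sub>F k in sequentially. norm (signal kap \<sigma> (ns k) (fs k)) \<le> (E * C4 * D * (2 powr r)\<^sup>2) * y k powr (- la)"
  proof eventually_elim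
    case (elim k)
    define n where "n = ns k"
    define N where "N = real n"
    define x where "x = lam k / real (kn kap n)"
    have n: "1 \<le> n" using ns1 by (simp add: n_def)
    have N: "0 < N" using n by (simp add: N_def)
    have x: "y k \<le> x" "1 < x" using ratio[of k] elim by (auto simp: x_def n_def)
    have q: "0 < real (kn kap n)" using D(4)[OF n] by simp
    have k0: "0 \<le> kapn kap n" by (simp add: kapn_def kw_def nonneg)
    \<comment> \<open>A4 with \<open>\<delta> = x - 1\<close>; as \<open>x\<close> times
      \<open>kn\<close> is \<open>lam k\<close>, this is the weight at the cut.\<close>
    have at: "kapat kap n x < C4 * x powr (- la) * kapn kap n"
      using C4(3)[of "x - 1" n] x n by simp
    define M where "M = C4 * y k powr (- la) * (D * N powr (2 * r - 2))"
    have "C4 * x powr (- la) * kapn kap n \<le> M"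
      unfolding M_def N_def using x(1) y0[of k] C4 D(1,2) n k0
      by (intro mult_mono mult_left_mono powr_mono2') auto
    then have at': "kapat kap n x \<le> M" using at by linarith
    have M0: "0 \<le> M" using C4 D by (simp add: M_def)
    have "kap n i \<le> M" if "fs k i \<noteq> 0" for i
    proof -
      have "lam k < real (Suc i)" using that by (auto simp: fs_def tail_def split: if_splits)
      \<comment> \<open>The weight at the cut has position one below the floor of
        \<open>lam k\<close>, and the support of the tail starts after it.\<close>
      then have "nat \<lfloor>lam k\<rfloor> - 1 \<le> i" by linarith
      then have "kap n i \<le> kap n (nat \<lfloor>lam k\<rfloor> - 1)" by (rule A1)
      also have "\<dots> = kapat kap n x" using q by (simp add: kapat_def kw_def x_def)
      finally show ?thesis using at' by linarith
    qed
    then have "signal kap \<sigma> n (fs k) \<le> E * (M * (l2norm (fs k))\<^sup>2 * (real n)\<^sup>2)"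
      by (intro E n l2 M0)
    also have "\<dots> \<le> E * (M * (2 powr r * N powr (- r))\<^sup>2 * N\<^sup>2)"
      using E M0 shell_hi[of k] e0[of k] unfolding N_def[symmetric] e_def[symmetric] n_def[symmetric]
      by (intro mult_left_mono mult_right_mono power_mono) auto
    also have "\<dots> = E * C4 * D * (2 powr r)\<^sup>2 * y k powr (- la) * (N powr (2 * r - 2) * N powr (- r) * N powr (- r) * N powr 2)"
      using N by (simp add: M_def power2_eq_square power_mult_distrib powr_numeral ac_simps)
    also have "N powr (2 * r - 2) * N powr (- r) * N powr (- r) * N powr 2 = 1"
      by (rule shell_powr_product[OF N])
    finally show ?case using sig0[of k] by (simp add: n_def)
  qed
  moreover have "(\<lambda>k. (E * C4 * D * (2 powr r)\<^sup>2) * y k powr (- la)) \<longlonglongrightarrow> (E * C4 * D * (2 powr r)\<^sup>2) * 0"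
    using C4(2) by (intro tendsto_mult tendsto_const tendsto_neg_powr y_top) simp
  then have "(\<lambda>k. (E * C4 * D * (2 powr r)\<^sup>2) * y k powr (- la)) \<longlonglongrightarrow> 0" by simp
  ultimately have "(\<lambda>k. signal kap \<sigma> (ns k) (fs k)) \<longlonglongrightarrow> 0" by (rule Lim_null_comparison)
  then have inc: "inconsistent kap \<sigma> ns fs" by (rule inconsistent_if_signal_vanishes[OF ns_top l2])
  have "\<forall>k. fs k \<in> V" unfolding fs_def using tail_in_convex_ortho_symmetric[OF V] by blast
  moreover have "(0 :: real) < 2 powr r" by simp
  then have "(1 / 2 :: real) < 2 powr r + 1" by linarith
  ultimately show ?thesis using ns_top shell inc
    by (intro exI[of _ "1 / 2"] exI[of _ "2 powr r + 1"] exI[of _ ns] exI[of _ fs]) simp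
qed

end

section \<open>Verification of the maxiset conditions\<close>

theorem theorem6:
  fixes kap :: "nat \<Rightarrow> nat \<Rightarrow> real" and \<sigma> r s P0 :: real
  assumes sigma: "0 < \<sigma>"
    and r: "0 < r" "r < 1/2"
    and s: "s = r / (2 - 4 * r)"
    and nonneg: "\<And>n i. 0 \<le> kap n i"
    and summ: "\<And>n. summable (kap n)"
    and A1: "\<And>n i j. i \<le> j \<Longrightarrow> kap n j \<le> kap n i"
    and A2: "\<exists>C1 C2. 0 < C1 \<and> (\<forall>n\<ge>1. C1 < real n ^ 2 / \<sigma> ^ 4 * (\<Sum>i. (kap n i)\<^sup>2)
                                   \<and> real n ^ 2 / \<sigma> ^ 4 * (\<Sum>i. (kap n i)\<^sup>2) < C2)"
    and A3: "\<exists>c1 c2. 0 < c1 \<and> 0 < c2 \<and> (\<forall>n\<ge>1. c1 * real n powr (-2 * r) \<le> rho kap n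
                                   \<and> rho kap n \<le> c2 * real n powr (-2 * r))"
    and A4: "\<exists>C1 lam. 0 < C1 \<and> 1 < lam \<and> (\<forall>\<delta>>0. \<forall>n\<ge>1.
               kapat kap n (1 + \<delta>) < C1 * (1 + \<delta>) powr (- lam) * kapn kap n)"
    and A5a: "\<exists>c C. 0 < c \<and> 0 < C \<and> (\<forall>n\<ge>1. c * kapn kap n \<le> kw kap n 1 \<and> kw kap n 1 \<le> C * kapn kap n)"
    and A5b: "\<And>c. 1 < c \<Longrightarrow> \<exists>C>0. \<forall>n\<ge>1. kapat kap n c \<ge> C * kapn kap n"
    and P0: "0 < P0"
  shows "maxiset kap \<sigma> r (besov_ball s P0)"
proof -
  interpret quadratic_test kap \<sigma> r s
    by unfold_locales (fact sigma r s nonneg summ A1 A2 A3 A4 A5a A5b)+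
  show ?thesis unfolding maxiset_def
  proof (intro conjI allI impI ballI)
    show "besov_ball s P0 \<subseteq> l2" by (auto simp: besov_ball_alt)
  next
    fix c C ns fs
    assume "0 < c \<and> c < C"
      and "filterlim ns at_top sequentially \<and> (\<forall>i. fs i \<in> besov_ball s P0) \<and> in_shell r c C ns fs"
    then show "consistent kap \<sigma> ns fs" using besov_shell_consistent P0 by blast
  next
    fix f V
    assume "f \<in> l2" "f \<notin> span_space (besov_ball s P0)"
      and "V \<subseteq> l2 \<and> l2convex V \<and> ortho_symmetric V \<and> f \<in> V"
    then show "\<exists>c C ns fs. 0 < c \<and> c < C \<and> filterlim ns at_top sequentially \<and>
              (\<forall>i. fs i \<in> V) \<and> in_shell r c C ns fs \<and> inconsistent kap \<sigma> ns fs"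
      using besov_tail_inconsistent[OF P0] by blast
  qed (fact besov_ball_bounded besov_ball_closed besov_ball_convex besov_ball_ortho_symmetric)+
qed

end
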